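(* Let $B$ be a paracompact Hausdorff space, $\mathcal{U}=\{U_0,\ldots,U_n\}$ an open cover of $B$, and $\{\varphi_r\}_{r=0}^n$ a partition of unity dominated by $\mathcal{U}$. For $\tau=\{\tau_{rt}\}\in Z^1(\mathcal{N}(\mathcal{U});\mathbb{Z}/2)$ let $f_\tau:B\to\mathbb{R}\mathbf{P}^n$ be the (well-defined) map $$f_\tau(b)=\left[(-1)^{\tau_{0j}}\sqrt{\varphi_0(b)}:\cdots:(-1)^{\tau_{nj}}\sqrt{\varphi_n(b)}\right],\qquad b\in U_j.$$ Let $\alpha=\{\alpha_r\}\in C^0(\mathcal{N}(\mathcal{U});\mathbb{Z}/2)$, let $\widetilde{\tau}=\tau+\delta^0(\alpha)$, and let $A_\alpha$ be the diagonal $(n+1)\times(n+1)$ matrix with diagonal entries $(-1)^{\alpha_0},\ldots,(-1)^{\alpha_n}$. Let $\mathbf{X}=\{\mathbf{x}_1,\ldots,\mathbf{x}_N\}\subset B$ be finite. Then $f_{\widetilde{\tau}}(\mathbf{X})=A_\alpha\cdot f_\tau(\mathbf{X})$ and $$\mathtt{PrinProjComps}(f_{\widetilde{\tau}}(\mathbf{X}))=A_\alpha\cdot\mathtt{PrinProjComps}(f_\tau(\mathbf{X})).$$ In particular, the profiles of cumulative variance of $f_{\widetilde{\tau}}(\mathbf{X})$ and $f_\tau(\mathbf{X})$ are identical. Moreover, the resulting projective coordinates for both point clouds differ by the isometry of $\mathbb{R}\mathbf{P}^n$ induced by $A_\alpha$.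
   Context: A partition of unity dominated by $\mathcal{U}=\{U_r\}$ is a collection of continuous maps $\varphi_r:U_r\to\mathbb{R}_{\ge0}$ such that $\sum_r\varphi_r=1$ and $\mathsf{support}(\varphi_r)\subset\mathsf{closure}(U_r)$; $\varphi_r(b)$ is read as $0$ for $b\notin U_r$, and the corresponding entry of $f_\tau(b)$ is then $0$. The nerve $\mathcal{N}(\mathcal{U})$ has one vertex $r$ for each $U_r$ and a simplex $\{r_0,\ldots,r_k\}$ whenever $U_{r_0}\cap\cdots\cap U_{r_k}\ne\emptyset$; cochains are $\mathbb{Z}/2$-valued functions on its simplices, $\delta$ is the simplicial coboundary, $Z^1$ is the group of 1-cocycles, $\tau_{rt}=\tau(\{r,t\})$ with $\tau_{rr}=0$, and $\alpha_r=\alpha(\{r\})$. Let $\mathbb{F}=\mathbb{R}$ or $\mathbb{C}$ (here $\mathbb{F}=\mathbb{R}$) and let $\dagger$ be conjugate transpose. For a matrix $A$ and $\mathbf{Y}=\{[\mathbf{y}_1],\ldots,[\mathbf{y}_N]\}$ in projective space, $A\cdot\mathbf{Y}=\{[A\mathbf{y}_1],\ldots,[A\mathbf{y}_N]\}$. For $\mathbf{Y}\subset\mathbb{F}\mathbf{P}^m$ let $\mathsf{Cov}(\mathbf{Y})=\sum_{r=1}^N\mathbf{y}_r\mathbf{y}_r^\dagger/\|\mathbf{y}_r\|^2$, and let $\mathtt{LastProjComp}(\mathbf{Y},\mathbb{F}\mathbf{P}^m)$ be the class $[\mathbf{u}]$ of an eigenvector $\mathbf{u}$ of $\mathsf{Cov}(\mathbf{Y})$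 corresponding to the smallest eigenvalue, with the understanding that it is unique only if that eigenspace has dimension one, and otherwise the choice is arbitrary. For $\mathbf{Y}\subset\mathbb{F}\mathbf{P}^n$, the principal projective components $\mathtt{PrinProjComps}(\mathbf{Y})=\{[\mathbf{v}_0],\ldots,[\mathbf{v}_n]\}$ are defined inductively: $[\mathbf{v}_n]=\mathtt{LastProjComp}(\mathbf{Y},\mathbb{F}\mathbf{P}^n)$; for $k=n-1,\ldots,1$, $[\mathbf{v}_k]=A_k\cdot\mathtt{LastProjComp}(A_k^\dagger\cdot\mathbf{Y},\mathbb{F}\mathbf{P}^k)$, where the columns of $A_k$ form an orthonormal basis of $\mathsf{Span}(\mathbf{v}_{k+1},\ldots,\mathbf{v}_n)^\perp$; and $\mathbf{v}_0$ is a unit vector with $\mathsf{Span}(\mathbf{v}_0)=\mathsf{Span}(\mathbf{v}_1,\ldots,\mathbf{v}_n)^\perp$. Choosing unit representatives $\mathbf{u}_i\in[\mathbf{v}_i]$, the principal projective coordinates of $[\mathbf{y}]\in\mathbb{F}\mathbf{P}^n$ are $[\langle\mathbf{y},\mathbf{u}_0\rangle:\cdots:\langle\mathbf{y},\mathbf{u}_n\rangle]\in\mathbb{F}\mathbf{P}^n$; they are unique up to a diagonal isometry. Cumulative variance: let $\mathbf{d}_g([\mathbf{u}],[\mathbf{v}])=\arccos\frac{|\langle\mathbf{u},\mathbf{v}\rangle|}{\|\mathbf{u}\|\|\mathbf{v}\|}$. For a linear subspace $V\subset\mathbb{F}^{n+1}$ let $\mathbb{F}\mathbf{P}_V\subset\mathbb{F}\mathbf{P}^n$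 be the set of lines contained in $V$, and let $P_V([\mathbf{u}])=[p_V(\mathbf{u})]$, where $p_V$ is orthogonal projection onto $V$. With $V^k=\mathsf{Span}(\mathbf{v}_0,\ldots,\mathbf{v}_k)$, the cumulative variance is $\mathsf{var}_{\mathbf{Y}}(k)=\frac1N\sum_{\ell=1}^k\sum_{r=1}^N\mathbf{d}_g\big(P_{V^\ell}([\mathbf{y}_r]),\mathbb{F}\mathbf{P}_{V^{\ell-1}}\big)^2$, $1\le k\le n$, where the distance to a set is the minimal distance to its points. *)

theory Defs
  imports
    "HOL-Analysis.T1_Spaces"
    "HOL-Library.Z2"
    "Jordan_Normal_Form.VS_Connect"
    "Jordan_Normal_Form.Char_Poly"
begin

section \<open>Covers, partitions of unity and the nerve\<close>

definition paracompact_space :: "'b topology \<Rightarrow> bool" where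
  "paracompact_space X \<longleftrightarrow>
     (\<forall>\<C>. (\<forall>C\<in>\<C>. openin X C) \<and> \<Union>\<C> = topspace X \<longrightarrow>
        (\<exists>\<D>. (\<forall>D\<in>\<D>. openin X D) \<and> \<Union>\<D> = topspace X \<and>
             (\<forall>D\<in>\<D>. \<exists>C\<in>\<C>. D \<subseteq> C) \<and> locally_finite_in X \<D>))"

text \<open>Covers are indexed families \<open>U 0, \<dots>, U n\<close>.  A function \<open>\<phi> r\<close> is only meaningful
  on \<open>U r\<close>; \<open>ext0\<close> reads it as \<open>0\<close> elsewhere.\<close>

definition ext0 :: "(nat \<Rightarrow> 'b set) \<Rightarrow> (nat \<Rightarrow> 'b \<Rightarrow> real) \<Rightarrow> nat \<Rightarrow> 'b \<Rightarrow> real" where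
  "ext0 U \<phi> r b = (if b \<in> U r then \<phi> r b else 0)"

definition dominated_partition_of_unity ::
    "'b topology \<Rightarrow> nat \<Rightarrow> (nat \<Rightarrow> 'b set) \<Rightarrow> (nat \<Rightarrow> 'b \<Rightarrow> real) \<Rightarrow> bool" where
  "dominated_partition_of_unity X n U \<phi> \<longleftrightarrow>
     (\<forall>r\<le>n. continuous_map (subtopology X (U r)) euclideanreal (\<phi> r) \<and>
            (\<forall>b\<in>U r. 0 \<le> \<phi> r b) \<and>
            X closure_of {b \<in> U r. \<phi> r b \<noteq> 0} \<subseteq> X closure_of (U r)) \<and>
     (\<forall>b\<in>topspace X. (\<Sum>r\<le>n. ext0 U \<phi> r b) = 1)"

text \<open>Every index is a vertex, also when the corresponding set is empty.\<close>

definition nerve :: "nat \<Rightarrow> (nat \<Rightarrow> 'b set) \<Rightarrow> nat set set" where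
  "nerve n U = {\<sigma>. \<sigma> \<noteq> {} \<and> \<sigma> \<subseteq> {..n} \<and> ((\<exists>r. \<sigma> = {r}) \<or> (\<Inter>r\<in>\<sigma>. U r) \<noteq> {})}"

definition simplices :: "nat \<Rightarrow> (nat \<Rightarrow> 'b set) \<Rightarrow> nat \<Rightarrow> nat set set" where
  "simplices n U k = {\<sigma> \<in> nerve n U. card \<sigma> = Suc k}"

text \<open>A \<open>k\<close>-cochain is a function on the \<open>k\<close>-simplices, extended by \<open>0\<close> to all sets of indices.\<close>

definition cochains :: "nat \<Rightarrow> (nat \<Rightarrow> 'b set) \<Rightarrow> nat \<Rightarrow> (nat set \<Rightarrow> bit) set" where
  "cochains n U k = {c. \<forall>\<sigma>. \<sigma> \<notin> simplices n U k \<longrightarrow> c \<sigma> = 0}"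

definition coboundary ::
    "nat \<Rightarrow> (nat \<Rightarrow> 'b set) \<Rightarrow> nat \<Rightarrow> (nat set \<Rightarrow> bit) \<Rightarrow> nat set \<Rightarrow> bit" where
  "coboundary n U k c \<sigma> = (if \<sigma> \<in> simplices n U (Suc k) then \<Sum>r\<in>\<sigma>. c (\<sigma> - {r}) else 0)"

definition cocycles :: "nat \<Rightarrow> (nat \<Rightarrow> 'b set) \<Rightarrow> nat \<Rightarrow> (nat set \<Rightarrow> bit) set" where
  "cocycles n U k = {c \<in> cochains n U k. coboundary n U k c = (\<lambda>\<sigma>. 0)}"

definition edge_val :: "(nat set \<Rightarrow> bit) \<Rightarrow> nat \<Rightarrow> nat \<Rightarrow> bit" where
  "edge_val \<tau> r t = (if r = t then 0 else \<tau> {r, t})"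

text \<open>\<open>(-1)\<^sup>b\<close> for \<open>b\<close> in \<open>\<int>/2\<close>.\<close>

definition z2_sign :: "bit \<Rightarrow> real" where
  "z2_sign b = (if b = 0 then 1 else - 1)"


section \<open>Real projective space\<close>

text \<open>Points of \<open>RP m\<close> are the lines through the origin of \<open>\<real>\<^sup>m\<^sup>+\<^sup>1\<close>, as subsets of
  \<^term>\<open>carrier_vec (Suc m)\<close>.\<close>

definition line :: "real vec \<Rightarrow> real vec set" where
  "line u = {c \<cdot>\<^sub>v u | c. True}"

definition RP :: "nat \<Rightarrow> real vec set set" where
  "RP m = {line u | u. u \<in> carrier_vec (Suc m) \<and> u \<noteq> 0\<^sub>v (Suc m)}"

definition rep :: "real vec set \<Rightarrow> real vec" where
  "rep p = (SOME u. u \<noteq> 0\<^sub>v (dim_vec u) \<and> p = line u)"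

definition vnorm :: "real vec \<Rightarrow> real" where
  "vnorm u = sqrt (u \<bullet> u)"

text \<open>\<open>A \<cdot> [y] = [A y]\<close>, written as an image of the line.  If \<open>A y = 0\<close> the result is
  \<open>{0}\<close>, which is not a point of projective space.\<close>

definition mat_line :: "real mat \<Rightarrow> real vec set \<Rightarrow> real vec set" where
  "mat_line A p = (\<lambda>u. A *\<^sub>v u) ` p"

definition mat_cloud :: "real mat \<Rightarrow> real vec set list \<Rightarrow> real vec set list" where
  "mat_cloud A Y = map (mat_line A) Y"

definition f_tau ::
    "nat \<Rightarrow> (nat \<Rightarrow> 'b set) \<Rightarrow> (nat \<Rightarrow> 'b \<Rightarrow> real) \<Rightarrow> (nat set \<Rightarrow> bit) \<Rightarrow> 'b \<Rightarrow> real vec set" where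
  "f_tau n U \<phi> \<tau> b =
     (THE p. \<forall>j\<le>n. b \<in> U j \<longrightarrow>
        p = line (vec (Suc n) (\<lambda>r. z2_sign (edge_val \<tau> r j) * sqrt (ext0 U \<phi> r b))))"

definition proj_dist :: "real vec set \<Rightarrow> real vec set \<Rightarrow> real" where
  "proj_dist p q = arccos (\<bar>rep p \<bullet> rep q\<bar> / (vnorm (rep p) * vnorm (rep q)))"


section \<open>Principal projective components\<close>

text \<open>\<open>Span m\<close> and \<open>Perp m\<close> are the linear span and the orthogonal complement in \<open>\<real>\<^sup>m\<close>.\<close>

abbreviation Span :: "nat \<Rightarrow> real vec set \<Rightarrow> real vec set" where
  "Span m S \<equiv> LinearCombinations.module.span class_ring (module_vec TYPE(real) m) S"

abbreviation Perp :: "nat \<Rightarrow> real vec set \<Rightarrow> real vec set" where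
  "Perp m W \<equiv> vec_module.orthogonal_complement m W"

text \<open>Point clouds are lists, so that repeated points count with multiplicity.  Entries of the form
  \<open>{0}\<close>, which arise as \<open>A\<^sub>k\<^sup>T \<cdot> [y]\<close> for \<open>y\<close> orthogonal to the columns of \<open>A\<^sub>k\<close>,
  do not contribute to the covariance.\<close>

definition Cov :: "nat \<Rightarrow> real vec set list \<Rightarrow> real mat" where
  "Cov m Y = mat (Suc m) (Suc m) (\<lambda>(i, j).
     \<Sum>p\<leftarrow>filter (\<lambda>p. p \<in> RP m) Y. rep p $ i * rep p $ j / (vnorm (rep p))\<^sup>2)"

text \<open>When the smallest eigenvalue is not simple the last component is an arbitrary choice;
  \<open>LastProjComp\<close> is the set of all admissible choices, and \<open>PrinProjComps\<close> the set of
  all sequences \<open>[v\<^sub>0], \<dots>, [v\<^sub>n]\<close> that the construction can produce.\<close>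

definition LastProjComp :: "nat \<Rightarrow> real vec set list \<Rightarrow> real vec set set" where
  "LastProjComp m Y =
     {line u | u ev. eigenvector (Cov m Y) u ev \<and> (\<forall>ev'. eigenvalue (Cov m Y) ev' \<longrightarrow> ev \<le> ev')}"

definition orthonormal_basis_cols :: "nat \<Rightarrow> nat \<Rightarrow> real mat \<Rightarrow> real vec set \<Rightarrow> bool" where
  "orthonormal_basis_cols m d A W \<longleftrightarrow>
     A \<in> carrier_mat m d \<and>
     (\<forall>i<d. \<forall>j<d. col A i \<bullet> col A j = (if i = j then 1 else 0)) \<and>
     Span m (set (cols A)) = W"

definition PrinProjComps :: "nat \<Rightarrow> real vec set list \<Rightarrow> real vec set list set" where
  "PrinProjComps n Y = {ps.
     length ps = Suc n \<and>
     ps ! n \<in> LastProjComp n Y \<and>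
     (\<forall>k\<in>{1..<n}. \<exists>A.
        orthonormal_basis_cols (Suc n) (Suc k) A
          (Perp (Suc n) (Span (Suc n) (\<Union>i\<in>{k<..n}. ps ! i))) \<and>
        ps ! k \<in> mat_line A ` LastProjComp k (mat_cloud (transpose_mat A) Y)) \<and>
     (\<exists>v\<in>carrier_vec (Suc n). vnorm v = 1 \<and>
        Span (Suc n) {v} = Perp (Suc n) (Span (Suc n) (\<Union>i\<in>{1..n}. ps ! i)) \<and>
        ps ! 0 = line v)}"

definition unit_reps :: "real vec set list \<Rightarrow> real vec list set" where
  "unit_reps ps = {us. length us = length ps \<and> (\<forall>i<length ps. us ! i \<in> ps ! i \<and> vnorm (us ! i) = 1)}"

definition proj_coords :: "nat \<Rightarrow> real vec list \<Rightarrow> real vec set \<Rightarrow> real vec set" where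
  "proj_coords n us p = line (vec (Suc n) (\<lambda>i. rep p \<bullet> us ! i))"

text \<open>All coordinate clouds of \<open>Y\<close> with respect to the components \<open>ps\<close>, over the choices
  of unit representatives; the same choice is used for all points of the cloud.\<close>

definition PrinProjCoords :: "nat \<Rightarrow> real vec set list \<Rightarrow> real vec set list \<Rightarrow> real vec set list set" where
  "PrinProjCoords n ps Y = {map (proj_coords n us) Y | us. us \<in> unit_reps ps}"


section \<open>Cumulative variance\<close>

definition orth_proj :: "nat \<Rightarrow> real vec set \<Rightarrow> real vec \<Rightarrow> real vec" where
  "orth_proj m V u = (THE w. w \<in> V \<and> u - w \<in> Perp m V)"

definition RP_sub :: "nat \<Rightarrow> real vec set \<Rightarrow> real vec set set" where
  "RP_sub m V = {p \<in> RP m. p \<subseteq> V}"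

definition proj_setdist :: "real vec set \<Rightarrow> real vec set set \<Rightarrow> real" where
  "proj_setdist p S = (INF q\<in>S. proj_dist p q)"

text \<open>As for \<open>Cov\<close>, points whose projection to \<open>V\<^sup>l\<close> vanishes, so that \<open>P\<^sub>V [y]\<close>
  is undefined, contribute nothing.\<close>

definition cum_var :: "nat \<Rightarrow> real vec set list \<Rightarrow> real vec set list \<Rightarrow> nat \<Rightarrow> real" where
  "cum_var n Y ps k =
     (let V = (\<lambda>l. Span (Suc n) (\<Union>i\<le>l. ps ! i));
          P = (\<lambda>l p. orth_proj (Suc n) (V l) ` p)
      in (1 / real (length Y)) *
         (\<Sum>l=1..k. \<Sum>p\<leftarrow>filter (\<lambda>p. P l p \<in> RP n) Y.
            (proj_setdist (P l p) (RP_sub n (V (l - 1))))\<^sup>2))"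

definition var_profile :: "nat \<Rightarrow> real vec set list \<Rightarrow> real vec set list \<Rightarrow> real list" where
  "var_profile n Y ps = map (cum_var n Y ps) [1..<Suc n]"

end

(* An orthogonal matrix A acts on lines by isometries and carries spans, orthogonal complements and
   orthogonal projections to the corresponding objects of the image.  Moreover Cov (A Y) A = A Cov Y,
   so A carries smallest eigenvectors to smallest eigenvectors; in the lower stages
   (A A_k)^T (A Y) = A_k^T Y, so the reduced point cloud does not change at all.  This gives one
   inclusion for the principal components, and A^T gives the other.  The coordinates of A y with
   respect to A u_0, ..., A u_n are those of y with respect to u_0, ..., u_n, and when A is a
   diagonal of signs its action on coordinates merely permutes the choices of unit representatives.
   Adding the coboundary of alpha changes f_tau exactly by the sign diagonal of alpha, because
   (-1)^(alpha_j) is an overall factor on U_j. *)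
theory Submission
  imports Defs
begin

section \<open>Linear algebra\<close>

text \<open>\<open>PrinProjComps\<close> and \<open>PrinProjCoords\<close> collect all outcomes of
  arbitrary choices, so no single outcome can be computed: every claim about them is proved by
  transporting choices along an orthogonal matrix. Only the coordinates and \<open>f_tau\<close>
  depend on the matrix being a diagonal of signs. Degenerate entries \<open>{0}\<close> shape two
  places. The behaviour of \<open>Cov\<close> under A is proved for clouds of genuine points, and it
  is used only at the top stage, where the cloud is still in \<open>RP n\<close>; at the lower
  stages the reduced clouds agree as lists, whatever \<open>{0}\<close> entries they contain. In the
  cumulative variance a projection can vanish, so there it must also be shown that A preserves which
  points the filter keeps. Finally, \<open>rep\<close>, \<open>orth_proj\<close> and
  \<open>f_tau\<close> come from choice or description operators. Each is first tied to explicit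
  data: \<open>rep\<close> up to a nonzero scalar, \<open>orth_proj\<close> through existence and
  uniqueness of orthogonal decompositions, \<open>f_tau\<close> through independence of the chart
  index.\<close>

lemma mult_mat_vec_zero:
  fixes A :: "real mat"
  assumes "A \<in> carrier_mat k m"
  shows "A *\<^sub>v 0\<^sub>v m = 0\<^sub>v k"
  using assms by (intro eq_vecI) auto

lemma Span_subset_carrier:
  assumes "S \<subseteq> carrier_vec m"
  shows "Span m S \<subseteq> carrier_vec m"
proof -
  interpret vec_space "TYPE(real)" m .
  show ?thesis using span_is_subset2[OF assms] .
qed

lemma subset_Span:
  assumes "S \<subseteq> carrier_vec m"
  shows "S \<subseteq> Span m S"
proof -
  interpret vec_space "TYPE(real)" m .
  show ?thesis using in_own_span[OF assms] .
qed

lemma Span_mono: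
  assumes "S \<subseteq> T"
  shows "Span m S \<subseteq> Span m T"
proof -
  interpret vec_space "TYPE(real)" m .
  show ?thesis using span_is_monotone[OF assms] .
qed

lemma zero_in_Span: "0\<^sub>v m \<in> Span m S"
proof -
  interpret vec_space "TYPE(real)" m .
  show ?thesis using span_zero by simp
qed

lemma add_in_Span:
  assumes "S \<subseteq> carrier_vec m" "x \<in> Span m S" "y \<in> Span m S"
  shows "x + y \<in> Span m S"
proof -
  interpret vec_space "TYPE(real)" m .
  show ?thesis using span_add1 assms by simp
qed

lemma smult_in_Span:
  assumes "S \<subseteq> carrier_vec m" "x \<in> Span m S"
  shows "c \<cdot>\<^sub>v x \<in> Span m S"
proof -
  interpret vec_space "TYPE(real)" m .
  show ?thesis using smult_in_span assms by simp
qed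

text \<open>Elementwise closure conditions are easy to check for images under a matrix, which is how
  this is applied.\<close>

lemma Span_minimal:
  assumes "S \<subseteq> W" "W \<subseteq> carrier_vec m" "0\<^sub>v m \<in> W"
    and "\<And>x y. x \<in> W \<Longrightarrow> y \<in> W \<Longrightarrow> x + y \<in> W"
    and "\<And>c x. x \<in> W \<Longrightarrow> c \<cdot>\<^sub>v x \<in> W"
  shows "Span m S \<subseteq> W"
proof -
  interpret vec_space "TYPE(real)" m .
  have "submodule class_ring W V"
    unfolding submodule_def using assms by (auto simp: module_vec_simps intro: module_axioms)
  then show ?thesis using span_is_subset[OF assms(1)] by simp
qed

section \<open>Orthogonal complements and norms\<close>

lemma mem_Perp_iff:
  "x \<in> Perp m W \<longleftrightarrow> x \<in> carrier_vec m \<and> (\<forall>y\<in>W. x \<bullet> y = 0)"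
  by (simp add: vec_module.orthogonal_complement_def)

lemma Perp_Span:
  assumes "S \<subseteq> carrier_vec m"
  shows "Perp m (Span m S) = Perp m S"
proof -
  interpret vec_space "TYPE(real)" m .
  show ?thesis using in_orthogonal_complement_span[OF assms] .
qed

lemma scalar_self_eq_0_iff:
  fixes u :: "real vec"
  assumes "u \<in> carrier_vec m"
  shows "u \<bullet> u = 0 \<longleftrightarrow> u = 0\<^sub>v m"
proof -
  have "u \<bullet> u = 0 \<longleftrightarrow> (\<forall>i<dim_vec u. u $ i = 0)"
    unfolding scalar_prod_def by (subst sum_nonneg_eq_0_iff) auto
  then show ?thesis using assms by (auto simp: vec_eq_iff)
qed

lemma vnorm_sq: "(vnorm u)\<^sup>2 = u \<bullet> u"
  unfolding vnorm_def scalar_prod_def by (simp add: sum_nonneg)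

lemma vnorm_pos:
  assumes "u \<in> carrier_vec m" "u \<noteq> 0\<^sub>v m"
  shows "vnorm u > 0"
proof -
  have "u \<bullet> u \<noteq> 0" using assms scalar_self_eq_0_iff[OF assms(1)] by simp
  moreover have "u \<bullet> u \<ge> 0" unfolding scalar_prod_def by (auto intro: sum_nonneg)
  ultimately show ?thesis by (simp add: vnorm_def)
qed

lemma vnorm_smult: "vnorm (c \<cdot>\<^sub>v u) = \<bar>c\<bar> * vnorm u"
proof -
  have "(c \<cdot>\<^sub>v u) \<bullet> (c \<cdot>\<^sub>v u) = c\<^sup>2 * (u \<bullet> u)"
    by (simp add: power2_eq_square)
  then show ?thesis by (simp add: vnorm_def real_sqrt_mult)
qed

section \<open>Lines\<close>

lemma self_in_line: "u \<in> line u"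
  unfolding line_def by (auto intro: exI[of _ 1])

lemma line_subset_carrier:
  assumes "u \<in> carrier_vec m"
  shows "line u \<subseteq> carrier_vec m"
  using assms unfolding line_def by auto

lemma line_smult:
  assumes "c \<noteq> 0"
  shows "line (c \<cdot>\<^sub>v u) = line u"
proof (intro Set.set_eqI iffI)
  fix x assume "x \<in> line (c \<cdot>\<^sub>v u)"
  then show "x \<in> line u" unfolding line_def by (auto simp: smult_smult_assoc)
next
  fix x assume "x \<in> line u"
  then obtain d where "x = d \<cdot>\<^sub>v u" unfolding line_def by auto
  then have "x = (d / c) \<cdot>\<^sub>v (c \<cdot>\<^sub>v u)" using assms by (simp add: smult_smult_assoc)
  then show "x \<in> line (c \<cdot>\<^sub>v u)" unfolding line_def by blast
qed

text \<open>\<open>rep\<close> is a Hilbert choice; any formula that is homogeneous of degree 0 in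
  it can be evaluated on any generator of the line by means of this lemma.\<close>

lemma rep_line:
  assumes "u \<in> carrier_vec m" "u \<noteq> 0\<^sub>v m"
  obtains c where "c \<noteq> 0" "rep (line u) = c \<cdot>\<^sub>v u"
proof -
  have "\<exists>w. w \<noteq> 0\<^sub>v (dim_vec w) \<and> line u = line w"
    using assms by (intro exI[of _ u]) auto
  then have r: "rep (line u) \<noteq> 0\<^sub>v (dim_vec (rep (line u)))" "line u = line (rep (line u))"
    unfolding rep_def using someI_ex[of "\<lambda>w. w \<noteq> 0\<^sub>v (dim_vec w) \<and> line u = line w"] by auto
  then obtain c where c: "rep (line u) = c \<cdot>\<^sub>v u"
    using self_in_line[of "rep (line u)"] unfolding line_def by auto
  have "c \<noteq> 0"
  proof
    assume "c = 0"
    then show False using r(1) c by auto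
  qed
  then show thesis using c that by blast
qed

lemma RP_E:
  assumes "p \<in> RP m"
  obtains u where "u \<in> carrier_vec (Suc m)" "u \<noteq> 0\<^sub>v (Suc m)" "p = line u"
  using assms unfolding RP_def by auto

lemma line_in_RP:
  assumes "u \<in> carrier_vec (Suc m)" "u \<noteq> 0\<^sub>v (Suc m)"
  shows "line u \<in> RP m"
  using assms unfolding RP_def by auto

lemma RP_subset_carrier:
  assumes "p \<in> RP m"
  shows "p \<subseteq> carrier_vec (Suc m)"
  using assms line_subset_carrier by (auto elim!: RP_E)

text \<open>The scalars relating \<open>rep\<close> to \<open>u\<close> and \<open>v\<close> enter
  numerator and norms through the same absolute values and cancel.\<close>

lemma proj_dist_line:
  assumes "u \<in> carrier_vec m" "u \<noteq> 0\<^sub>v m" "v \<in> carrier_vec m" "v \<noteq> 0\<^sub>v m"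
  shows "proj_dist (line u) (line v) = arccos (\<bar>u \<bullet> v\<bar> / (vnorm u * vnorm v))"
proof -
  obtain c where c: "c \<noteq> 0" "rep (line u) = c \<cdot>\<^sub>v u" using rep_line assms by metis
  obtain d where d: "d \<noteq> 0" "rep (line v) = d \<cdot>\<^sub>v v" using rep_line assms by metis
  have "(c \<cdot>\<^sub>v u) \<bullet> (d \<cdot>\<^sub>v v) = c * d * (u \<bullet> v)" using assms by simp
  then show ?thesis unfolding proj_dist_def c d
    using c(1) d(1) by (simp add: vnorm_smult abs_mult)
qed

lemma mat_line_line:
  assumes "A \<in> carrier_mat k m" "u \<in> carrier_vec m"
  shows "mat_line A (line u) = line (A *\<^sub>v u)"
  using assms unfolding mat_line_def line_def by (force simp: mult_mat_vec image_iff)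

lemma mat_line_mult:
  assumes "A \<in> carrier_mat k l" "C \<in> carrier_mat l m" "p \<subseteq> carrier_vec m"
  shows "mat_line (A * C) p = mat_line A (mat_line C p)"
proof -
  have "(A * C) *\<^sub>v u = A *\<^sub>v (C *\<^sub>v u)" if "u \<in> p" for u
    using assms that by (intro assoc_mult_mat_vec) auto
  then show ?thesis unfolding mat_line_def image_image by (rule image_cong[OF refl])
qed

section \<open>Orthogonal matrices\<close>

text \<open>Requiring both products makes the notion visibly symmetric in \<open>A\<close> and its
  transpose, so that every one-sided result can be reapplied to the transpose.\<close>

definition orth_mat :: "nat \<Rightarrow> real mat \<Rightarrow> bool" where
  "orth_mat m A \<longleftrightarrow> A \<in> carrier_mat m m \<and> transpose_mat A * A = 1\<^sub>m m \<and> A * transpose_mat A = 1\<^sub>m m"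

lemma orth_mat_transpose: "orth_mat m A \<Longrightarrow> orth_mat m (transpose_mat A)"
  unfolding orth_mat_def by auto

lemma orth_mat_carrier: "orth_mat m A \<Longrightarrow> A \<in> carrier_mat m m"
  unfolding orth_mat_def by auto

lemma orth_mat_cancel:
  assumes "orth_mat m A" "u \<in> carrier_vec m"
  shows "transpose_mat A *\<^sub>v (A *\<^sub>v u) = u" "A *\<^sub>v (transpose_mat A *\<^sub>v u) = u"
proof -
  have A: "A \<in> carrier_mat m m" "transpose_mat A \<in> carrier_mat m m"
    using assms(1) unfolding orth_mat_def by auto
  have "transpose_mat A *\<^sub>v (A *\<^sub>v u) = (transpose_mat A * A) *\<^sub>v u"
    using assoc_mult_mat_vec[OF A(2,1) assms(2)] by simp
  then show "transpose_mat A *\<^sub>v (A *\<^sub>v u) = u"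
    using assms unfolding orth_mat_def by simp
  have "A *\<^sub>v (transpose_mat A *\<^sub>v u) = (A * transpose_mat A) *\<^sub>v u"
    using assoc_mult_mat_vec[OF A assms(2)] by simp
  then show "A *\<^sub>v (transpose_mat A *\<^sub>v u) = u"
    using assms unfolding orth_mat_def by simp
qed

lemma orth_mat_scalar:
  assumes "orth_mat m A" "u \<in> carrier_vec m" "v \<in> carrier_vec m"
  shows "(A *\<^sub>v u) \<bullet> (A *\<^sub>v v) = u \<bullet> v"
proof -
  have A: "A \<in> carrier_mat m m" using assms(1) by (rule orth_mat_carrier)
  have "(transpose_mat A *\<^sub>v (A *\<^sub>v u)) \<bullet> v = (A *\<^sub>v u) \<bullet> (A *\<^sub>v v)"
    using A assms by (intro transpose_vec_mult_scalar) auto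
  then show ?thesis using orth_mat_cancel[OF assms(1,2)] by simp
qed

lemma orth_mat_vnorm:
  assumes "orth_mat m A" "u \<in> carrier_vec m"
  shows "vnorm (A *\<^sub>v u) = vnorm u"
  using orth_mat_scalar[OF assms(1,2,2)] by (simp add: vnorm_def)

lemma orth_mat_nonzero:
  assumes "orth_mat m A" "u \<in> carrier_vec m" "u \<noteq> 0\<^sub>v m"
  shows "A *\<^sub>v u \<noteq> 0\<^sub>v m"
proof
  assume "A *\<^sub>v u = 0\<^sub>v m"
  then have "vnorm u = vnorm (0\<^sub>v m)" using orth_mat_vnorm[OF assms(1,2)] by simp
  then show False using vnorm_pos[OF assms(2,3)] by (simp add: vnorm_def)
qed

text \<open>Holds for arbitrary sets of vectors; it is applied to lines, spanning sets and subspaces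
  alike.\<close>

lemma orth_mat_cancel_line:
  assumes "orth_mat m A" "p \<subseteq> carrier_vec m"
  shows "mat_line (transpose_mat A) (mat_line A p) = p"
proof -
  have "transpose_mat A *\<^sub>v (A *\<^sub>v u) = u" if "u \<in> p" for u
    using orth_mat_cancel(1)[OF assms(1)] assms(2) that by blast
  then show ?thesis unfolding mat_line_def image_image by simp
qed

lemma mat_line_in_RP:
  assumes "orth_mat (Suc m) A" "p \<in> RP m"
  shows "mat_line A p \<in> RP m"
proof -
  have A: "A \<in> carrier_mat (Suc m) (Suc m)" using assms(1) by (rule orth_mat_carrier)
  obtain u where u: "u \<in> carrier_vec (Suc m)" "u \<noteq> 0\<^sub>v (Suc m)" "p = line u"
    using assms(2) by (rule RP_E)
  then show ?thesis using mat_line_line[OF A u(1)] orth_mat_nonzero[OF assms(1) u(1,2)] A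
    by (auto intro!: line_in_RP)
qed

text \<open>Here \<open>p\<close> may fail to be a line: it will be the projection of a line to a
  subspace, possibly \<open>{0}\<close>, and the equivalence shows that the filter in
  \<open>cum_var\<close> keeps corresponding points.\<close>

lemma mat_line_in_RP_iff:
  assumes "orth_mat (Suc m) A" "p \<subseteq> carrier_vec (Suc m)"
  shows "mat_line A p \<in> RP m \<longleftrightarrow> p \<in> RP m"
  using mat_line_in_RP[OF assms(1)] mat_line_in_RP[OF orth_mat_transpose[OF assms(1)]]
    orth_mat_cancel_line[OF assms] by metis

lemma proj_dist_mat_line:
  assumes "orth_mat (Suc m) A" "p \<in> RP m" "q \<in> RP m"
  shows "proj_dist (mat_line A p) (mat_line A q) = proj_dist p q"
proof -
  have A: "A \<in> carrier_mat (Suc m) (Suc m)" using assms(1) by (rule orth_mat_carrier)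
  obtain u where u: "u \<in> carrier_vec (Suc m)" "u \<noteq> 0\<^sub>v (Suc m)" "p = line u"
    using assms(2) by (rule RP_E)
  obtain v where v: "v \<in> carrier_vec (Suc m)" "v \<noteq> 0\<^sub>v (Suc m)" "q = line v"
    using assms(3) by (rule RP_E)
  have Au: "A *\<^sub>v u \<in> carrier_vec (Suc m)" "A *\<^sub>v v \<in> carrier_vec (Suc m)" using A u v by auto
  show ?thesis
    using proj_dist_line[OF Au(1) orth_mat_nonzero[OF assms(1) u(1,2)] Au(2) orth_mat_nonzero[OF assms(1) v(1,2)]]
      proj_dist_line[OF u(1,2) v(1,2)]
    by (simp add: u(3) v(3) mat_line_line[OF A u(1)] mat_line_line[OF A v(1)]
        orth_mat_scalar[OF assms(1) u(1) v(1)] orth_mat_vnorm[OF assms(1)] u(1) v(1))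
qed

lemma bij_betw_mat_line:
  assumes "orth_mat (Suc m) A"
  shows "bij_betw (mat_line A) (RP m) (RP m)"
proof (rule bij_betw_byWitness)
  note T = orth_mat_transpose[OF assms]
  show "\<forall>p\<in>RP m. mat_line (transpose_mat A) (mat_line A p) = p"
    using orth_mat_cancel_line[OF assms RP_subset_carrier] by blast
  show "\<forall>p\<in>RP m. mat_line A (mat_line (transpose_mat A) p) = p"
    using orth_mat_cancel_line[OF T RP_subset_carrier] by (simp add: Matrix.transpose_transpose)
  show "mat_line A ` RP m \<subseteq> RP m" "mat_line (transpose_mat A) ` RP m \<subseteq> RP m"
    using mat_line_in_RP[OF assms] mat_line_in_RP[OF T] by auto
qed

text \<open>\<open>mat_line A\<close> is just the image of a set of vectors, so it also serves for subspaces.\<close>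

lemma Span_mat_line_aux:
  assumes "A \<in> carrier_mat m m" "S \<subseteq> carrier_vec m"
  shows "Span m (mat_line A S) \<subseteq> mat_line A (Span m S)"
proof (rule Span_minimal)
  have c: "Span m S \<subseteq> carrier_vec m" using Span_subset_carrier[OF assms(2)] .
  show "mat_line A S \<subseteq> mat_line A (Span m S)"
    using subset_Span[OF assms(2)] unfolding mat_line_def by auto
  show "mat_line A (Span m S) \<subseteq> carrier_vec m" using assms(1) unfolding mat_line_def by (auto intro: carrier_vecI)
  show "0\<^sub>v m \<in> mat_line A (Span m S)"
    unfolding mat_line_def
    using zero_in_Span by (intro image_eqI[of _ _ "0\<^sub>v m"] mult_mat_vec_zero[OF assms(1), symmetric])
  show "x + y \<in> mat_line A (Span m S)"
    if xy: "x \<in> mat_line A (Span m S)" "y \<in> mat_line A (Span m S)" for x y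
  proof -
    obtain a b where "a \<in> Span m S" "b \<in> Span m S" "x = A *\<^sub>v a" "y = A *\<^sub>v b"
      using xy unfolding mat_line_def by auto
    moreover from this have "x + y = A *\<^sub>v (a + b)"
      using mult_add_distrib_mat_vec[OF assms(1) subsetD[OF c] subsetD[OF c]] by simp
    ultimately show ?thesis
      using add_in_Span[OF assms(2)] unfolding mat_line_def by blast
  qed
  show "k \<cdot>\<^sub>v x \<in> mat_line A (Span m S)" if x: "x \<in> mat_line A (Span m S)" for k x
  proof -
    obtain a where "a \<in> Span m S" "x = A *\<^sub>v a" using x unfolding mat_line_def by auto
    moreover from this have "k \<cdot>\<^sub>v x = A *\<^sub>v (k \<cdot>\<^sub>v a)"
      using mult_mat_vec[OF assms(1) subsetD[OF c]] by simp
    ultimately show ?thesis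
      using smult_in_Span[OF assms(2)] unfolding mat_line_def by blast
  qed
qed

lemma mat_line_subset_carrier:
  assumes "A \<in> carrier_mat m k"
  shows "mat_line A S \<subseteq> carrier_vec m"
  using assms unfolding mat_line_def by (auto intro: carrier_vecI)

lemma mat_line_mono: "S \<subseteq> T \<Longrightarrow> mat_line A S \<subseteq> mat_line A T"
  unfolding mat_line_def by auto

text \<open>The reverse inclusion is the forward one for \<open>transpose_mat A\<close> and the set
  \<open>mat_line A S\<close>, carried back by \<open>A\<close>.\<close>

lemma Span_mat_line:
  assumes "orth_mat m A" "S \<subseteq> carrier_vec m"
  shows "Span m (mat_line A S) = mat_line A (Span m S)"
proof
  note A = orth_mat_carrier[OF assms(1)]
  note T = orth_mat_transpose[OF assms(1)]
  show "Span m (mat_line A S) \<subseteq> mat_line A (Span m S)"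
    using Span_mat_line_aux[OF A assms(2)] .
  have AS: "mat_line A S \<subseteq> carrier_vec m" using mat_line_subset_carrier[OF A] .
  have "Span m S \<subseteq> mat_line (transpose_mat A) (Span m (mat_line A S))"
    using Span_mat_line_aux[OF orth_mat_carrier[OF T] AS] orth_mat_cancel_line[OF assms] by simp
  then have "mat_line A (Span m S) \<subseteq> mat_line A (mat_line (transpose_mat A) (Span m (mat_line A S)))"
    by (rule mat_line_mono)
  then show "mat_line A (Span m S) \<subseteq> Span m (mat_line A S)"
    using orth_mat_cancel_line[OF T Span_subset_carrier[OF AS]] by (simp add: Matrix.transpose_transpose)
qed

lemma Perp_mat_line:
  assumes "orth_mat m A" "W \<subseteq> carrier_vec m"
  shows "Perp m (mat_line A W) = mat_line A (Perp m W)"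
proof (intro Set.set_eqI iffI)
  note A = orth_mat_carrier[OF assms(1)]
  fix x assume x: "x \<in> mat_line A (Perp m W)"
  then show "x \<in> Perp m (mat_line A W)"
    using A assms(2) orth_mat_scalar[OF assms(1)] unfolding mat_line_def
    by (auto simp: mem_Perp_iff)
next
  note A = orth_mat_carrier[OF assms(1)]
  fix x assume x: "x \<in> Perp m (mat_line A W)"
  let ?y = "transpose_mat A *\<^sub>v x"
  have xc: "x \<in> carrier_vec m" using x by (simp add: mem_Perp_iff)
  have yc: "?y \<in> carrier_vec m" using xc A by simp
  have "?y \<bullet> w = 0" if "w \<in> W" for w
    using x that assms(2) transpose_vec_mult_scalar[OF A _ xc, of w]
    by (auto simp: mem_Perp_iff mat_line_def)
  then have "?y \<in> Perp m W" using yc by (simp add: mem_Perp_iff)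
  then show "x \<in> mat_line A (Perp m W)"
    using orth_mat_cancel(2)[OF assms(1) xc] unfolding mat_line_def by (metis image_eqI)
qed

section \<open>Principal projective components\<close>

text \<open>A point of projective space contributes to \<open>Cov\<close> the orthogonal projection
  onto its line. Recording the action on a vector, rather than the matrix, prepares induction over
  the cloud.\<close>

lemma Cov_Cons_mult:
  assumes "x \<in> carrier_vec (Suc m)"
  shows "Cov m (p # Y) *\<^sub>v x =
    (if p \<in> RP m then ((rep p \<bullet> x) / (rep p \<bullet> rep p)) \<cdot>\<^sub>v rep p else 0\<^sub>v (Suc m)) + Cov m Y *\<^sub>v x"
proof (cases "p \<in> RP m")
  case True
  obtain u where u: "u \<in> carrier_vec (Suc m)" "u \<noteq> 0\<^sub>v (Suc m)" "p = line u"
    using True by (rule RP_E)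
  have r: "rep p \<in> carrier_vec (Suc m)" using rep_line[OF u(1,2)] u by (metis smult_carrier_vec)
  show ?thesis
  proof (rule eq_vecI)
    fix i assume "i < dim_vec ((if p \<in> RP m then ((rep p \<bullet> x) / (rep p \<bullet> rep p)) \<cdot>\<^sub>v rep p else 0\<^sub>v (Suc m)) + Cov m Y *\<^sub>v x)"
    then have i: "i < Suc m" using True r by (simp add: Cov_def)
    show "(Cov m (p # Y) *\<^sub>v x) $ i =
      ((if p \<in> RP m then ((rep p \<bullet> x) / (rep p \<bullet> rep p)) \<cdot>\<^sub>v rep p else 0\<^sub>v (Suc m)) + Cov m Y *\<^sub>v x) $ i"
      using True i r assms
      by (simp add: Cov_def vnorm_sq scalar_prod_def[of _ x] distrib_left sum.distrib sum_distrib_left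
          sum_divide_distrib sum_distrib_right mult_ac del: sum.op_ivl_Suc)
  qed (use True r in \<open>simp add: Cov_def\<close>)
next
  case False
  then have "Cov m (p # Y) = Cov m Y" unfolding Cov_def by simp
  moreover have "Cov m Y *\<^sub>v x \<in> carrier_vec (Suc m)" by (rule carrier_vecI) (simp add: Cov_def)
  ultimately show ?thesis using False by simp
qed

text \<open>Each summand obeys the rule by itself: projecting \<open>A *\<^sub>v x\<close> to the
  line of \<open>A *\<^sub>v u\<close> gives \<open>A\<close> applied to the projection of
  \<open>x\<close> to the line of \<open>u\<close>.\<close>

lemma Cov_mat_cloud_mult:
  assumes "orth_mat (Suc m) A" "set Y \<subseteq> RP m" "x \<in> carrier_vec (Suc m)"
  shows "Cov m (mat_cloud A Y) *\<^sub>v (A *\<^sub>v x) = A *\<^sub>v (Cov m Y *\<^sub>v x)"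
  using assms(2)
proof (induction Y)
  case Nil
  have "Cov m [] *\<^sub>v y = 0\<^sub>v (Suc m)" if "y \<in> carrier_vec (Suc m)" for y
    using that unfolding Cov_def by (intro eq_vecI) (auto simp: scalar_prod_def)
  then show ?case
    using mult_mat_vec_zero[OF orth_mat_carrier[OF assms(1)]] orth_mat_carrier[OF assms(1)] assms(3)
    by (simp add: mat_cloud_def)
next
  case (Cons p Y)
  note A = orth_mat_carrier[OF assms(1)]
  have p: "p \<in> RP m" "mat_line A p \<in> RP m" using Cons.prems mat_line_in_RP[OF assms(1)] by auto
  obtain u where u: "u \<in> carrier_vec (Suc m)" "u \<noteq> 0\<^sub>v (Suc m)" "p = line u"
    using p(1) by (rule RP_E)
  have Ap: "mat_line A p = line (A *\<^sub>v u)" using mat_line_line[OF A u(1)] u(3) by simp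
  have Au: "A *\<^sub>v u \<in> carrier_vec (Suc m)" "A *\<^sub>v x \<in> carrier_vec (Suc m)" using A u(1) assms(3) by auto
  obtain c where c: "c \<noteq> 0" "rep p = c \<cdot>\<^sub>v u" using rep_line[OF u(1,2)] u(3) by metis
  obtain d where d: "d \<noteq> 0" "rep (mat_line A p) = d \<cdot>\<^sub>v (A *\<^sub>v u)"
    using rep_line[OF Au(1) orth_mat_nonzero[OF assms(1) u(1,2)]] Ap by metis
  \<comment> \<open>\<open>rep (mat_line A p)\<close> is a choice unrelated to
    \<open>A *\<^sub>v rep p\<close>. Scale invariance of the rank-one term allows both to be
    replaced by \<open>A *\<^sub>v u\<close> and \<open>u\<close>.\<close>
  have outer: "(((c \<cdot>\<^sub>v w) \<bullet> y) / ((c \<cdot>\<^sub>v w) \<bullet> (c \<cdot>\<^sub>v w))) \<cdot>\<^sub>v (c \<cdot>\<^sub>v w) = ((w \<bullet> y) / (w \<bullet> w)) \<cdot>\<^sub>v w"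
    if "c \<noteq> 0" "w \<in> carrier_vec (Suc m)" "y \<in> carrier_vec (Suc m)" for c :: real and w y :: "real vec"
    using that by (simp add: smult_smult_assoc)
  have CY: "Cov m Y *\<^sub>v x \<in> carrier_vec (Suc m)" by (rule carrier_vecI) (simp add: Cov_def)
  have "Cov m (mat_cloud A (p # Y)) *\<^sub>v (A *\<^sub>v x) =
      ((u \<bullet> x) / (u \<bullet> u)) \<cdot>\<^sub>v (A *\<^sub>v u) + A *\<^sub>v (Cov m Y *\<^sub>v x)"
    using Cov_Cons_mult[OF Au(2), of "mat_line A p" "mat_cloud A Y"] Cons p(2) d
      outer[OF d(1) Au] orth_mat_scalar[OF assms(1) u(1)] u(1) assms(3)
    by (simp add: mat_cloud_def)
  also have "\<dots> = A *\<^sub>v (((u \<bullet> x) / (u \<bullet> u)) \<cdot>\<^sub>v u + Cov m Y *\<^sub>v x)"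
    using u(1) CY by (simp add: mult_add_distrib_mat_vec[OF A] mult_mat_vec[OF A])
  also have "((u \<bullet> x) / (u \<bullet> u)) \<cdot>\<^sub>v u + Cov m Y *\<^sub>v x = Cov m (p # Y) *\<^sub>v x"
    using Cov_Cons_mult[OF assms(3), of p Y] p(1) c outer[OF c(1) u(1) assms(3)] by simp
  finally show ?case .
qed

lemma mat_cloud_cancel:
  assumes "orth_mat m A" "\<forall>p\<in>set Y. p \<subseteq> carrier_vec m"
  shows "mat_cloud (transpose_mat A) (mat_cloud A Y) = Y"
  using assms(2) orth_mat_cancel_line[OF assms(1)] unfolding mat_cloud_def
  by (simp add: map_idI)

lemma mat_cloud_subset_RP:
  assumes "orth_mat (Suc m) A" "set Y \<subseteq> RP m"
  shows "set (mat_cloud A Y) \<subseteq> RP m"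
  using assms mat_line_in_RP[OF assms(1)] unfolding mat_cloud_def by auto

lemma eigenvector_Cov_mat_cloud:
  assumes "orth_mat (Suc m) A" "set Y \<subseteq> RP m" "eigenvector (Cov m Y) u ev"
  shows "eigenvector (Cov m (mat_cloud A Y)) (A *\<^sub>v u) ev"
proof -
  note A = orth_mat_carrier[OF assms(1)]
  have u: "u \<in> carrier_vec (Suc m)" "u \<noteq> 0\<^sub>v (Suc m)" "Cov m Y *\<^sub>v u = ev \<cdot>\<^sub>v u"
    using assms(3) unfolding eigenvector_def Cov_def by auto
  have "Cov m (mat_cloud A Y) *\<^sub>v (A *\<^sub>v u) = ev \<cdot>\<^sub>v (A *\<^sub>v u)"
    using Cov_mat_cloud_mult[OF assms(1,2) u(1)] u(3) mult_mat_vec[OF A u(1)] by simp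
  moreover have "dim_row (Cov m (mat_cloud A Y)) = Suc m" unfolding Cov_def by simp
  ultimately show ?thesis
    unfolding eigenvector_def using A u(1) orth_mat_nonzero[OF assms(1) u(1,2)] by simp
qed

text \<open>The direction from the moved cloud back to \<open>Y\<close>, obtained from the
  transpose, is what minimality in \<open>LastProjComp\<close> rests on: a competing eigenvalue of
  the new matrix must already compete in the old one.\<close>

lemma eigenvalue_Cov_mat_cloud:
  assumes "orth_mat (Suc m) A" "set Y \<subseteq> RP m"
  shows "eigenvalue (Cov m (mat_cloud A Y)) ev \<longleftrightarrow> eigenvalue (Cov m Y) ev"
proof -
  have "mat_cloud (transpose_mat A) (mat_cloud A Y) = Y"
    using mat_cloud_cancel[OF assms(1)] assms(2) RP_subset_carrier by blast
  then show ?thesis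
    using eigenvector_Cov_mat_cloud[OF assms]
      eigenvector_Cov_mat_cloud[OF orth_mat_transpose[OF assms(1)] mat_cloud_subset_RP[OF assms]]
    unfolding eigenvalue_def by metis
qed

lemma LastProjComp_subset_RP: "LastProjComp m Y \<subseteq> RP m"
  unfolding LastProjComp_def eigenvector_def by (auto simp: Cov_def intro: line_in_RP)

lemma mat_line_LastProjComp:
  assumes "orth_mat (Suc m) A" "set Y \<subseteq> RP m" "p \<in> LastProjComp m Y"
  shows "mat_line A p \<in> LastProjComp m (mat_cloud A Y)"
proof -
  obtain u ev where u: "p = line u" "eigenvector (Cov m Y) u ev"
      "\<forall>ev'. eigenvalue (Cov m Y) ev' \<longrightarrow> ev \<le> ev'"
    using assms(3) unfolding LastProjComp_def by auto
  have "u \<in> carrier_vec (Suc m)" using u(2) unfolding eigenvector_def Cov_def by auto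
  then have "mat_line A p = line (A *\<^sub>v u)"
    using mat_line_line[OF orth_mat_carrier[OF assms(1)]] u(1) by simp
  then show ?thesis
    unfolding LastProjComp_def
    using eigenvector_Cov_mat_cloud[OF assms(1,2) u(2)] u(3) eigenvalue_Cov_mat_cloud[OF assms(1,2)]
    by auto
qed

section \<open>The inductive construction under an orthogonal matrix\<close>

lemma mat_cloud_transpose_mult:
  assumes "orth_mat m A" "C \<in> carrier_mat m k" "\<forall>p\<in>set Y. p \<subseteq> carrier_vec m"
  shows "mat_cloud (transpose_mat (A * C)) (mat_cloud A Y) = mat_cloud (transpose_mat C) Y"
proof -
  note A = orth_mat_carrier[OF assms(1)]
  have "mat_line (transpose_mat (A * C)) (mat_line A p) = mat_line (transpose_mat C) p"
    if "p \<in> set Y" for p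
  proof -
    have p: "p \<subseteq> carrier_vec m" using assms(3) that by auto
    have "mat_line (transpose_mat (A * C)) (mat_line A p)
        = mat_line (transpose_mat C) (mat_line (transpose_mat A) (mat_line A p))"
      unfolding transpose_mult[OF A assms(2)]
      using A assms(2) by (intro mat_line_mult[OF _ _ mat_line_subset_carrier[OF A]]) auto
    then show ?thesis using orth_mat_cancel_line[OF assms(1) p] by simp
  qed
  then show ?thesis unfolding mat_cloud_def by simp
qed

lemma orthonormal_basis_cols_mult:
  assumes "orth_mat m A" "orthonormal_basis_cols m d C W"
  shows "orthonormal_basis_cols m d (A * C) (mat_line A W)"
proof -
  note A = orth_mat_carrier[OF assms(1)]
  have C: "C \<in> carrier_mat m d" "Span m (set (cols C)) = W"
      "\<forall>i<d. \<forall>j<d. col C i \<bullet> col C j = (if i = j then 1 else 0)"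
    using assms(2) unfolding orthonormal_basis_cols_def by auto
  have col: "col (A * C) i = A *\<^sub>v col C i" if "i < d" for i
    using col_mult2[OF A C(1) that] .
  have "set (cols (A * C)) = mat_line A (set (cols C))"
    unfolding cols_def mat_line_def using A C(1) col by force
  moreover have "set (cols C) \<subseteq> carrier_vec m" using C(1) cols_dim[of C] by auto
  ultimately show ?thesis
    unfolding orthonormal_basis_cols_def
    using A C col orth_mat_scalar[OF assms(1)] Span_mat_line[OF assms(1)] by auto
qed

text \<open>The indices must be in range because \<open>!\<close> past the end of a list is
  unspecified and does not commute with \<open>map\<close>.\<close>

lemma UN_mat_cloud:
  assumes "I \<subseteq> {..<length ps}"
  shows "(\<Union>i\<in>I. mat_cloud A ps ! i) = mat_line A (\<Union>i\<in>I. ps ! i)"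
  using assms unfolding mat_cloud_def mat_line_def by force

text \<open>The middle components need an argument: orthonormal columns give
  \<open>transpose_mat C * C = 1\<^sub>m (Suc k)\<close>, so \<open>C\<close> is injective and sends
  the line \<open>q\<close> to a line rather than to \<open>{0}\<close>.\<close>

lemma PrinProjComps_subset_RP:
  assumes "ps \<in> PrinProjComps n Y"
  shows "set ps \<subseteq> RP n"
proof
  fix p assume "p \<in> set ps"
  then obtain k where k: "k \<le> n" "p = ps ! k"
    using assms unfolding PrinProjComps_def by (auto simp: in_set_conv_nth less_Suc_eq_le)
  consider "k = n" | "k = 0" | "k \<in> {1..<n}" using k(1) by force
  then show "p \<in> RP n"
  proof cases
    case 1
    then show ?thesis using assms k LastProjComp_subset_RP unfolding PrinProjComps_def by blast
  next
    case 2
    then obtain v where v: "v \<in> carrier_vec (Suc n)" "vnorm v = 1" "p = line v"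
      using assms k(2) unfolding PrinProjComps_def by auto
    then have "v \<noteq> 0\<^sub>v (Suc n)" by (auto simp: vnorm_def)
    then show ?thesis using v line_in_RP by simp
  next
    case 3
    then obtain C W q where C: "orthonormal_basis_cols (Suc n) (Suc k) C W"
        and q: "q \<in> LastProjComp k (mat_cloud (transpose_mat C) Y)" "p = mat_line C q"
      using assms k(2) unfolding PrinProjComps_def by blast
    have Cc: "C \<in> carrier_mat (Suc n) (Suc k)"
      and Co: "\<forall>i<Suc k. \<forall>j<Suc k. col C i \<bullet> col C j = (if i = j then 1 else 0)"
      using C unfolding orthonormal_basis_cols_def by auto
    have CC: "transpose_mat C * C = 1\<^sub>m (Suc k)"
      using Cc Co by (intro eq_matI) auto
    have "q \<in> RP k" using q(1) LastProjComp_subset_RP by blast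
    then obtain u where u: "u \<in> carrier_vec (Suc k)" "u \<noteq> 0\<^sub>v (Suc k)" "q = line u" by (rule RP_E)
    have "u = transpose_mat C *\<^sub>v (C *\<^sub>v u)"
      using CC assoc_mult_mat_vec[of "transpose_mat C" "Suc k" "Suc n" C "Suc k" u] Cc u(1) by simp
    then have "C *\<^sub>v u \<noteq> 0\<^sub>v (Suc n)" using u(2) Cc by auto
    then show ?thesis using q(2) u mat_line_line[OF Cc u(1)] Cc by (auto intro!: line_in_RP)
  qed
qed

text \<open>Every choice for \<open>Y\<close> yields one for the moved cloud: a basis matrix
  \<open>C\<close> becomes \<open>A * C\<close>, the unit vector \<open>v\<close> becomes
  \<open>A *\<^sub>v v\<close>, and the choice \<open>q\<close> inside the reduced cloud is kept as
  it is.\<close>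

lemma mat_cloud_PrinProjComps:
  assumes A: "orth_mat (Suc n) A" and Y: "set Y \<subseteq> RP n" and ps: "ps \<in> PrinProjComps n Y"
  shows "mat_cloud A ps \<in> PrinProjComps n (mat_cloud A Y)"
proof -
  note Ac = orth_mat_carrier[OF A]
  have len: "length ps = Suc n" using ps unfolding PrinProjComps_def by simp
  have psc: "(\<Union>i\<in>I. ps ! i) \<subseteq> carrier_vec (Suc n)" if "I \<subseteq> {..n}" for I
    using PrinProjComps_subset_RP[OF ps] RP_subset_carrier len that
    by (force simp: set_conv_nth less_Suc_eq_le)
  have perp: "Perp (Suc n) (Span (Suc n) (\<Union>i\<in>I. mat_cloud A ps ! i))
      = mat_line A (Perp (Suc n) (Span (Suc n) (\<Union>i\<in>I. ps ! i)))" if I: "I \<subseteq> {..n}" for I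
  proof -
    have "I \<subseteq> {..<length ps}" using I len by (auto simp: less_Suc_eq_le)
    then show ?thesis
      using UN_mat_cloud[of I ps A] Span_mat_line[OF A psc[OF I]]
        Perp_mat_line[OF A Span_subset_carrier[OF psc[OF I]]] by simp
  qed
  have nth: "mat_cloud A ps ! k = mat_line A (ps ! k)" if "k \<le> n" for k
    using that len unfolding mat_cloud_def by simp
  have Yc: "\<forall>p\<in>set Y. p \<subseteq> carrier_vec (Suc n)" using Y RP_subset_carrier by blast
  have "\<exists>C. orthonormal_basis_cols (Suc n) (Suc k) C
          (Perp (Suc n) (Span (Suc n) (\<Union>i\<in>{k<..n}. mat_cloud A ps ! i))) \<and>
        mat_cloud A ps ! k \<in> mat_line C ` LastProjComp k (mat_cloud (transpose_mat C) (mat_cloud A Y))"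
    if k: "k \<in> {1..<n}" for k
  proof -
    obtain C q where C: "orthonormal_basis_cols (Suc n) (Suc k) C
          (Perp (Suc n) (Span (Suc n) (\<Union>i\<in>{k<..n}. ps ! i)))"
        and q: "q \<in> LastProjComp k (mat_cloud (transpose_mat C) Y)" "ps ! k = mat_line C q"
      using ps k unfolding PrinProjComps_def by blast
    have Cc: "C \<in> carrier_mat (Suc n) (Suc k)" using C unfolding orthonormal_basis_cols_def by simp
    have "q \<subseteq> carrier_vec (Suc k)" using q(1) LastProjComp_subset_RP RP_subset_carrier by blast
    then have "mat_cloud A ps ! k = mat_line (A * C) q"
      using nth k q(2) mat_line_mult[OF Ac Cc] by simp
    moreover have "{k<..n} \<subseteq> {..n}" by auto
    ultimately show ?thesis
      using orthonormal_basis_cols_mult[OF A C] perp[of "{k<..n}"] q(1)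
        mat_cloud_transpose_mult[OF A Cc Yc] by (intro exI[of _ "A * C"]) auto
  qed
  moreover have "\<exists>v\<in>carrier_vec (Suc n). vnorm v = 1 \<and>
        Span (Suc n) {v} = Perp (Suc n) (Span (Suc n) (\<Union>i\<in>{1..n}. mat_cloud A ps ! i)) \<and>
        mat_cloud A ps ! 0 = line v"
  proof -
    obtain v where v: "v \<in> carrier_vec (Suc n)" "vnorm v = 1"
        "Span (Suc n) {v} = Perp (Suc n) (Span (Suc n) (\<Union>i\<in>{1..n}. ps ! i))" "ps ! 0 = line v"
      using ps unfolding PrinProjComps_def by auto
    have "Span (Suc n) {A *\<^sub>v v} = mat_line A (Span (Suc n) {v})"
      using Span_mat_line[OF A, of "{v}"] v(1) by (simp add: mat_line_def)
    then have "Span (Suc n) {A *\<^sub>v v} = Perp (Suc n) (Span (Suc n) (\<Union>i\<in>{1..n}. mat_cloud A ps ! i))"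
      using v(3) perp[of "{1..n}"] by auto
    then show ?thesis
      using v Ac orth_mat_vnorm[OF A v(1)] nth[of 0] mat_line_line[OF Ac v(1)]
      by (intro bexI[of _ "A *\<^sub>v v"]) auto
  qed
  moreover have "mat_cloud A ps ! n \<in> LastProjComp n (mat_cloud A Y)"
    using ps nth[of n] mat_line_LastProjComp[OF A Y] unfolding PrinProjComps_def by auto
  moreover have "length (mat_cloud A ps) = Suc n" using len unfolding mat_cloud_def by simp
  ultimately show ?thesis unfolding PrinProjComps_def by blast
qed

lemma PrinProjComps_mat_cloud:
  assumes A: "orth_mat (Suc n) A" and Y: "set Y \<subseteq> RP n"
  shows "PrinProjComps n (mat_cloud A Y) = mat_cloud A ` PrinProjComps n Y"
proof (intro Set.set_eqI iffI)
  fix ps assume ps: "ps \<in> PrinProjComps n (mat_cloud A Y)"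
  note T = orth_mat_transpose[OF A]
  have "mat_cloud (transpose_mat A) (mat_cloud A Y) = Y"
    using mat_cloud_cancel[OF A] Y RP_subset_carrier by blast
  then have "mat_cloud (transpose_mat A) ps \<in> PrinProjComps n Y"
    using mat_cloud_PrinProjComps[OF T mat_cloud_subset_RP[OF A Y] ps] by simp
  moreover have "mat_cloud A (mat_cloud (transpose_mat A) ps) = ps"
    using mat_cloud_cancel[OF T, of ps] PrinProjComps_subset_RP[OF ps] RP_subset_carrier
    by (auto simp: Matrix.transpose_transpose)
  ultimately show "ps \<in> mat_cloud A ` PrinProjComps n Y" by force
qed (use mat_cloud_PrinProjComps[OF A Y] in auto)

section \<open>Orthogonal projections and cumulative variance\<close>

text \<open>One Gram-Schmidt step: \<open>z\<close> is the part of \<open>u\<close> orthogonal to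
  the old span, and the component of \<open>x - w\<close> along \<open>z\<close> is moved into the
  projection.\<close>

lemma orth_decomp_insert:
  assumes S: "S \<subseteq> carrier_vec m" and u: "u \<in> carrier_vec m"
    and ex: "\<And>x. x \<in> carrier_vec m \<Longrightarrow> \<exists>w\<in>Span m S. x - w \<in> Perp m (Span m S)"
    and x: "x \<in> carrier_vec m"
  shows "\<exists>w\<in>Span m (S \<union> line u). x - w \<in> Perp m (Span m (S \<union> line u))"
proof -
  have Sc: "w \<in> carrier_vec m" if "w \<in> Span m S" for w
    using Span_subset_carrier[OF S] that by blast
  have SL: "S \<union> line u \<subseteq> carrier_vec m" using S line_subset_carrier[OF u] by simp
  obtain v where v: "v \<in> Span m S" "u - v \<in> Perp m (Span m S)" using ex[OF u] by auto
  obtain w where w: "w \<in> Span m S" "x - w \<in> Perp m (Span m S)" using ex[OF x] by auto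
  note vc = Sc[OF v(1)] and wc = Sc[OF w(1)]
  define z where "z = u - v"
  have z: "z \<in> carrier_vec m" "\<And>y. y \<in> Span m S \<Longrightarrow> z \<bullet> y = 0"
    using v(2) by (auto simp: z_def mem_Perp_iff)
  have xw: "x - w \<in> carrier_vec m" "\<And>y. y \<in> Span m S \<Longrightarrow> (x - w) \<bullet> y = 0"
    using w(2) by (auto simp: mem_Perp_iff)
  \<comment> \<open>If \<open>u\<close> already lies in the old span, then \<open>z\<close> vanishes
    and the quotient is 0/0, read as 0; \<open>cz\<close> still holds, so the case split ends
    there.\<close>
  define c where "c = ((x - w) \<bullet> z) / (z \<bullet> z)"
  have cz: "(x - w) \<bullet> z = c * (z \<bullet> z)"
  proof (cases "z = 0\<^sub>v m")
    case True
    then show ?thesis using xw(1) by simp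
  next
    case False
    then show ?thesis using scalar_self_eq_0_iff[OF z(1)] by (simp add: c_def)
  qed
  define w' where "w' = w + c \<cdot>\<^sub>v z"
  have zS: "z \<in> Span m (S \<union> line u)"
  proof -
    have "z = u + (-1) \<cdot>\<^sub>v v" using u vc by (intro eq_vecI) (auto simp: z_def)
    moreover have "u \<in> Span m (S \<union> line u)" using subset_Span[OF SL] self_in_line by auto
    moreover have "v \<in> Span m (S \<union> line u)" using v(1) Span_mono[of S "S \<union> line u"] by blast
    ultimately show ?thesis using add_in_Span[OF SL] smult_in_Span[OF SL] by metis
  qed
  have "w' \<in> Span m (S \<union> line u)"
    unfolding w'_def using w(1) Span_mono[of S "S \<union> line u" m] zS
    by (intro add_in_Span[OF SL] smult_in_Span[OF SL]) auto
  moreover have "x - w' \<in> Perp m (Span m (S \<union> line u))"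
  proof -
    have d: "x - w' = (x - w) - c \<cdot>\<^sub>v z"
      unfolding w'_def using x wc z(1) by (intro eq_vecI) auto
    have dy: "(x - w') \<bullet> y = (x - w) \<bullet> y - c * (z \<bullet> y)" if "y \<in> carrier_vec m" for y
      unfolding d using xw(1) z(1) that by (simp add: minus_scalar_prod_distrib[of _ m])
    have orthS: "(x - w') \<bullet> y = 0" if "y \<in> Span m S" for y
      using dy[OF Sc[OF that]] xw(2)[OF that] z(2)[OF that] by simp
    have dc: "x - w' \<in> carrier_vec m" unfolding d using xw(1) z(1) by simp
    \<comment> \<open>Orthogonality to \<open>u\<close> is tested on both summands: \<open>v\<close>
      lies in the old span, and \<open>z\<close> is handled by the choice of
      \<open>c\<close>.\<close>
    have "u = v + z" using u vc by (intro eq_vecI) (auto simp: z_def)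
    then have "(x - w') \<bullet> u = (x - w') \<bullet> v + (x - w') \<bullet> z"
      using scalar_prod_add_distrib[OF dc vc z(1)] by simp
    also have "\<dots> = 0" using orthS[OF v(1)] dy[OF z(1)] cz by simp
    finally have "(x - w') \<bullet> (k \<cdot>\<^sub>v u) = 0" for k using dc u by simp
    then have "x - w' \<in> Perp m (S \<union> line u)"
      using dc orthS subset_Span[OF S] by (auto simp: mem_Perp_iff line_def)
    then show ?thesis using Perp_Span[OF SL] by simp
  qed
  ultimately show ?thesis by blast
qed

text \<open>Supplies the existence behind the definite description in \<open>orth_proj\<close>, for
  exactly the subspaces \<open>V l\<close> of the cumulative variance.\<close>

lemma ex_orth_decomp:
  assumes "finite I" "\<forall>i\<in>I. \<exists>u\<in>carrier_vec m. p i = line u" "x \<in> carrier_vec m"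
  shows "\<exists>w\<in>Span m (\<Union>i\<in>I. p i). x - w \<in> Perp m (Span m (\<Union>i\<in>I. p i))"
  using assms
proof (induction I arbitrary: x rule: finite_induct)
  case empty
  have "x - 0\<^sub>v m \<in> Perp m (Span m {})"
    using Perp_Span[of "{}" m] empty.prems by (simp add: mem_Perp_iff)
  then show ?case using zero_in_Span by auto
next
  case (insert i I)
  obtain u where u: "u \<in> carrier_vec m" "p i = line u" using insert.prems(1) by auto
  have "(\<Union>i\<in>I. p i) \<subseteq> carrier_vec m" using insert.prems(1) line_subset_carrier by fastforce
  then have "\<exists>w\<in>Span m ((\<Union>i\<in>I. p i) \<union> line u).
      x - w \<in> Perp m (Span m ((\<Union>i\<in>I. p i) \<union> line u))"
    using insert.prems(1) by (intro orth_decomp_insert[OF _ u(1) insert.IH insert.prems(2)]) auto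
  then show ?case using u(2) by (simp add: Un_commute)
qed

text \<open>Uniqueness: the difference of two candidates lies in the span and is also a difference
  of two vectors of its complement, hence is orthogonal to itself.\<close>

lemma orth_proj_eq:
  assumes "S \<subseteq> carrier_vec m" "x \<in> carrier_vec m" "w \<in> Span m S" "x - w \<in> Perp m (Span m S)"
  shows "orth_proj m (Span m S) x = w"
  unfolding orth_proj_def
proof (rule the_equality)
  show "w \<in> Span m S \<and> x - w \<in> Perp m (Span m S)" using assms by simp
  fix w' assume w': "w' \<in> Span m S \<and> x - w' \<in> Perp m (Span m S)"
  have c: "w \<in> carrier_vec m" "w' \<in> carrier_vec m"
    using Span_subset_carrier[OF assms(1)] assms(3) w' by auto
  have d: "w' + (-1) \<cdot>\<^sub>v w = (x - w) - (x - w')" using c assms(2) by (intro eq_vecI) auto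
  have "w' + (-1) \<cdot>\<^sub>v w \<in> Span m S"
    using w' assms(3) by (intro add_in_Span smult_in_Span assms(1)) auto
  then have "((x - w) - (x - w')) \<bullet> (w' + (-1) \<cdot>\<^sub>v w) = 0"
    using w' assms c by (subst minus_scalar_prod_distrib[of _ m]) (auto simp: mem_Perp_iff)
  moreover have "w' + (-1) \<cdot>\<^sub>v w \<in> carrier_vec m" using c by simp
  ultimately have "w' + (-1) \<cdot>\<^sub>v w = 0\<^sub>v m"
    using scalar_self_eq_0_iff unfolding d by blast
  then have "(w' + (-1) \<cdot>\<^sub>v w) $ i = 0" if "i < m" for i using that by simp
  then show "w' = w" using c by (intro eq_vecI) auto
qed

text \<open>The image under \<open>A\<close> of an orthogonal decomposition of \<open>x\<close> is
  one of \<open>A *\<^sub>v x\<close>, and such a decomposition determines the projection.\<close>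

lemma orth_proj_mat_line:
  assumes A: "orth_mat m A" and S: "S \<subseteq> carrier_vec m" and x: "x \<in> carrier_vec m"
    and ex: "\<exists>w\<in>Span m S. x - w \<in> Perp m (Span m S)"
  shows "orth_proj m (mat_line A (Span m S)) (A *\<^sub>v x) = A *\<^sub>v orth_proj m (Span m S) x"
proof -
  note Ac = orth_mat_carrier[OF A]
  obtain w where w: "w \<in> Span m S" "x - w \<in> Perp m (Span m S)" using ex by auto
  have wc: "w \<in> carrier_vec m" using Span_subset_carrier[OF S] w(1) by blast
  have AS: "Span m (mat_line A S) = mat_line A (Span m S)" by (rule Span_mat_line[OF A S])
  have "A *\<^sub>v w \<in> Span m (mat_line A S)" unfolding AS using w(1) by (simp add: mat_line_def)
  moreover have "A *\<^sub>v x - A *\<^sub>v w \<in> Perp m (Span m (mat_line A S))"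
    unfolding AS Perp_mat_line[OF A Span_subset_carrier[OF S]]
    using w(2) mult_minus_distrib_mat_vec[OF Ac x wc] by (metis image_eqI mat_line_def)
  ultimately have "orth_proj m (Span m (mat_line A S)) (A *\<^sub>v x) = A *\<^sub>v w"
    using Ac x mat_line_subset_carrier[OF Ac] by (intro orth_proj_eq) auto
  then show ?thesis using orth_proj_eq[OF S x w] AS by simp
qed

section \<open>Invariance of distances to subspaces and of the cumulative variance\<close>

lemma RP_sub_mat_line:
  assumes A: "orth_mat (Suc n) A" and V: "V \<subseteq> carrier_vec (Suc n)"
  shows "RP_sub n (mat_line A V) = mat_line A ` RP_sub n V"
proof (intro Set.set_eqI iffI)
  note T = orth_mat_transpose[OF A]
  fix p assume p: "p \<in> RP_sub n (mat_line A V)"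
  then have "mat_line (transpose_mat A) p \<subseteq> mat_line (transpose_mat A) (mat_line A V)"
    unfolding RP_sub_def by (intro mat_line_mono) auto
  then have "mat_line (transpose_mat A) p \<in> RP_sub n V"
    using p mat_line_in_RP[OF T] orth_mat_cancel_line[OF A V] unfolding RP_sub_def by simp
  moreover have "p = mat_line A (mat_line (transpose_mat A) p)"
    using p orth_mat_cancel_line[OF T RP_subset_carrier] unfolding RP_sub_def
    by (simp add: Matrix.transpose_transpose)
  ultimately show "p \<in> mat_line A ` RP_sub n V" by blast
next
  fix p assume "p \<in> mat_line A ` RP_sub n V"
  then show "p \<in> RP_sub n (mat_line A V)"
    using mat_line_in_RP[OF A] mat_line_mono unfolding RP_sub_def by blast
qed

text \<open>Both infima range over the same set of real values.\<close>

lemma proj_setdist_mat_line: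
  assumes A: "orth_mat (Suc n) A" and "p \<in> RP n" "S \<subseteq> RP n"
  shows "proj_setdist (mat_line A p) (mat_line A ` S) = proj_setdist p S"
proof -
  have "proj_dist (mat_line A p) (mat_line A q) = proj_dist p q" if "q \<in> S" for q
    using proj_dist_mat_line[OF A assms(2)] assms(3) that by blast
  then show ?thesis unfolding proj_setdist_def image_image by simp
qed

lemma sum_list_filter_map:
  fixes f :: "'c \<Rightarrow> 'd::comm_monoid_add"
  assumes "\<And>y. y \<in> set ys \<Longrightarrow> Q (g y) \<longleftrightarrow> Q' y" "\<And>y. y \<in> set ys \<Longrightarrow> Q' y \<Longrightarrow> f (g y) = f' y"
  shows "(\<Sum>p\<leftarrow>filter Q (map g ys). f p) = (\<Sum>p\<leftarrow>filter Q' ys. f' p)"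
  using assms by (induction ys) auto

text \<open>The spans \<open>V l\<close>, the projections and the sets \<open>RP_sub\<close> all
  move along with \<open>A\<close>, so the filters keep corresponding points and the sums agree term
  by term.\<close>

lemma cum_var_mat_cloud:
  assumes A: "orth_mat (Suc n) A" and Y: "set Y \<subseteq> RP n" and ps: "set ps \<subseteq> RP n"
    and k: "k < length ps"
  shows "cum_var n (mat_cloud A Y) (mat_cloud A ps) k = cum_var n Y ps k"
proof -
  define V where "V l = Span (Suc n) (\<Union>i\<le>l. ps ! i)" for l
  have lines: "\<forall>i\<in>{..l}. \<exists>u\<in>carrier_vec (Suc n). ps ! i = line u" if "l \<le> k" for l
  proof
    fix i assume "i \<in> {..l}"
    then have "ps ! i \<in> RP n" using that k ps by auto
    then obtain u where u: "u \<in> carrier_vec (Suc n)" "ps ! i = line u" by (rule RP_E)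
    show "\<exists>u\<in>carrier_vec (Suc n). ps ! i = line u" using u by (intro bexI[of _ u])
  qed
  have psc: "(\<Union>i\<le>l. ps ! i) \<subseteq> carrier_vec (Suc n)" if "l \<le> k" for l
  proof (rule UN_least)
    fix i assume "i \<in> {..l}"
    then have "ps ! i \<in> RP n" using that k ps by auto
    then show "ps ! i \<subseteq> carrier_vec (Suc n)" by (rule RP_subset_carrier)
  qed
  have Vc: "V l \<subseteq> carrier_vec (Suc n)" if "l \<le> k" for l
    unfolding V_def using Span_subset_carrier[OF psc[OF that]] .
  have V': "Span (Suc n) (\<Union>i\<le>l. mat_cloud A ps ! i) = mat_line A (V l)" if "l \<le> k" for l
  proof -
    have "{..l} \<subseteq> {..<length ps}" using that k by auto
    then show ?thesis
      unfolding V_def using UN_mat_cloud[of "{..l}" ps A] Span_mat_line[OF A psc[OF that]] by simp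
  qed
  have ex: "\<exists>w\<in>V l. x - w \<in> Perp (Suc n) (V l)" if "l \<le> k" "x \<in> carrier_vec (Suc n)" for l x
    unfolding V_def using ex_orth_decomp[OF finite_atMost lines[OF that(1)] that(2)] .
  have P: "orth_proj (Suc n) (mat_line A (V l)) ` mat_line A p = mat_line A (orth_proj (Suc n) (V l) ` p)"
    if "l \<le> k" "p \<in> RP n" for l p
  proof -
    have "orth_proj (Suc n) (mat_line A (V l)) (A *\<^sub>v x) = A *\<^sub>v orth_proj (Suc n) (V l) x"
      if "x \<in> p" for x
      using orth_proj_mat_line[OF A psc[OF \<open>l \<le> k\<close>], of x] ex[OF \<open>l \<le> k\<close>, of x]
        RP_subset_carrier[OF \<open>p \<in> RP n\<close>] that unfolding V_def by blast
    then show ?thesis unfolding mat_line_def image_image by simp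
  qed
  have Pc: "orth_proj (Suc n) (V l) ` p \<subseteq> carrier_vec (Suc n)" if l: "l \<le> k" and p: "p \<in> RP n" for l p
  proof
    fix y assume "y \<in> orth_proj (Suc n) (V l) ` p"
    then obtain x where x: "x \<in> p" "y = orth_proj (Suc n) (V l) x" by auto
    have xc: "x \<in> carrier_vec (Suc n)" using x(1) RP_subset_carrier[OF p] by blast
    obtain w where "w \<in> V l" "x - w \<in> Perp (Suc n) (V l)" using ex[OF l xc] by auto
    then have "y = w" using orth_proj_eq[OF psc[OF l] xc, of w] x(2) unfolding V_def by simp
    then show "y \<in> carrier_vec (Suc n)" using \<open>w \<in> V l\<close> Vc[OF l] by blast
  qed
  define F where "F l = (\<Sum>p\<leftarrow>filter (\<lambda>p. orth_proj (Suc n) (V l) ` p \<in> RP n) Y.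
      (proj_setdist (orth_proj (Suc n) (V l) ` p) (RP_sub n (V (l - 1))))\<^sup>2)" for l
  define F' where "F' l = (\<Sum>p\<leftarrow>filter (\<lambda>p. orth_proj (Suc n) (Span (Suc n) (\<Union>i\<le>l. mat_cloud A ps ! i)) ` p \<in> RP n) (mat_cloud A Y).
      (proj_setdist (orth_proj (Suc n) (Span (Suc n) (\<Union>i\<le>l. mat_cloud A ps ! i)) ` p)
        (RP_sub n (Span (Suc n) (\<Union>i\<le>l - 1. mat_cloud A ps ! i))))\<^sup>2)" for l
  have "F' l = F l"
    if l: "l \<le> k" for l
  proof -
    have l1: "l - 1 \<le> k" using l by simp
    show ?thesis
      unfolding F'_def F_def V'[OF l] V'[OF l1] RP_sub_mat_line[OF A Vc[OF l1]] mat_cloud_def[of A Y]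
    proof (rule sum_list_filter_map)
      fix p assume "p \<in> set Y"
      then have p: "p \<in> RP n" using Y by auto
      show "orth_proj (Suc n) (mat_line A (V l)) ` mat_line A p \<in> RP n
          \<longleftrightarrow> orth_proj (Suc n) (V l) ` p \<in> RP n"
        unfolding P[OF l p] by (rule mat_line_in_RP_iff[OF A Pc[OF l p]])
      assume q: "orth_proj (Suc n) (V l) ` p \<in> RP n"
      have "RP_sub n (V (l - 1)) \<subseteq> RP n" unfolding RP_sub_def by auto
      then show "(proj_setdist (orth_proj (Suc n) (mat_line A (V l)) ` mat_line A p)
            (mat_line A ` RP_sub n (V (l - 1))))\<^sup>2
          = (proj_setdist (orth_proj (Suc n) (V l) ` p) (RP_sub n (V (l - 1))))\<^sup>2"
        unfolding P[OF l p] using proj_setdist_mat_line[OF A q] by simp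
    qed
  qed
  then have "(\<Sum>l=1..k. F' l) = (\<Sum>l=1..k. F l)" by (intro sum.cong) auto
  moreover have "length (mat_cloud A Y) = length Y" by (simp add: mat_cloud_def)
  ultimately show ?thesis unfolding cum_var_def Let_def F'_def F_def V_def by simp
qed

lemma var_profile_mat_cloud:
  assumes "orth_mat (Suc n) A" "set Y \<subseteq> RP n" "ps \<in> PrinProjComps n Y"
  shows "var_profile n (mat_cloud A Y) (mat_cloud A ps) = var_profile n Y ps"
proof -
  have "length ps = Suc n" using assms(3) unfolding PrinProjComps_def by simp
  then show ?thesis
    unfolding var_profile_def
    using cum_var_mat_cloud[OF assms(1,2) PrinProjComps_subset_RP[OF assms(3)]] by auto
qed

section \<open>Projective coordinates\<close>

lemma unit_reps_mat_cloud:
  assumes A: "orth_mat m A" and ps: "\<forall>p\<in>set ps. p \<subseteq> carrier_vec m" and us: "us \<in> unit_reps ps"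
  shows "map ((*\<^sub>v) A) us \<in> unit_reps (mat_cloud A ps)"
proof -
  have "us ! i \<in> carrier_vec m" if "i < length ps" for i
    using ps us that nth_mem unfolding unit_reps_def by blast
  then show ?thesis
    using us orth_mat_vnorm[OF A] unfolding unit_reps_def mat_cloud_def mat_line_def by auto
qed

text \<open>Changing the representative of the point rescales all coordinates by the same nonzero
  factor.\<close>

lemma proj_coords_line:
  assumes "u \<in> carrier_vec (Suc n)" "u \<noteq> 0\<^sub>v (Suc n)" "\<forall>i\<le>n. us ! i \<in> carrier_vec (Suc n)"
  shows "proj_coords n us (line u) = line (vec (Suc n) (\<lambda>i. u \<bullet> us ! i))"
proof -
  obtain c where c: "c \<noteq> 0" "rep (line u) = c \<cdot>\<^sub>v u" using rep_line[OF assms(1,2)] by metis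
  have "vec (Suc n) (\<lambda>i. (c \<cdot>\<^sub>v u) \<bullet> us ! i) = c \<cdot>\<^sub>v vec (Suc n) (\<lambda>i. u \<bullet> us ! i)"
    using assms(1,3) by (intro eq_vecI) (auto simp: less_Suc_eq_le)
  then show ?thesis unfolding proj_coords_def c(2) using line_smult[OF c(1)] by simp
qed

lemma proj_coords_mat_line:
  assumes A: "orth_mat (Suc n) A" and p: "p \<in> RP n" and len: "length us = Suc n"
    and us: "\<forall>i\<le>n. us ! i \<in> carrier_vec (Suc n)"
  shows "proj_coords n (map ((*\<^sub>v) A) us) (mat_line A p) = proj_coords n us p"
proof -
  note Ac = orth_mat_carrier[OF A]
  obtain u where u: "u \<in> carrier_vec (Suc n)" "u \<noteq> 0\<^sub>v (Suc n)" "p = line u" using p by (rule RP_E)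
  have Au: "A *\<^sub>v u \<in> carrier_vec (Suc n)" using Ac u(1) by simp
  have Aus: "\<forall>i\<le>n. map ((*\<^sub>v) A) us ! i \<in> carrier_vec (Suc n)" using us len Ac by simp
  have "vec (Suc n) (\<lambda>i. (A *\<^sub>v u) \<bullet> map ((*\<^sub>v) A) us ! i) = vec (Suc n) (\<lambda>i. u \<bullet> us ! i)"
    using orth_mat_scalar[OF A u(1)] us len by (intro eq_vecI) (auto simp: less_Suc_eq_le)
  then show ?thesis
    using proj_coords_line[OF Au orth_mat_nonzero[OF A u(1,2)] Aus] proj_coords_line[OF u(1,2) us]
      u(3) mat_line_line[OF Ac u(1)] by simp
qed

lemma unit_reps_carrier:
  assumes "set ps \<subseteq> RP n" "length ps = Suc n" "us \<in> unit_reps ps"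
  shows "length us = Suc n" "\<forall>i\<le>n. us ! i \<in> carrier_vec (Suc n)"
proof -
  have us: "length us = length ps" "\<forall>i<length ps. us ! i \<in> ps ! i"
    using assms(3) unfolding unit_reps_def by auto
  then show "length us = Suc n" using assms(2) by simp
  show "\<forall>i\<le>n. us ! i \<in> carrier_vec (Suc n)"
  proof (intro allI impI)
    fix i assume "i \<le> n"
    then have "i < length ps" using assms(2) by simp
    then have "ps ! i \<in> RP n" "us ! i \<in> ps ! i" using assms(1) us(2) nth_mem by blast+
    then show "us ! i \<in> carrier_vec (Suc n)" using RP_subset_carrier by blast
  qed
qed

lemma PrinProjCoords_mat_cloud_subset:
  assumes A: "orth_mat (Suc n) A" and Y: "set Y \<subseteq> RP n" and ps: "set ps \<subseteq> RP n" "length ps = Suc n"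
  shows "PrinProjCoords n ps Y \<subseteq> PrinProjCoords n (mat_cloud A ps) (mat_cloud A Y)"
proof
  fix Z assume "Z \<in> PrinProjCoords n ps Y"
  then obtain us where us: "us \<in> unit_reps ps" "Z = map (proj_coords n us) Y"
    unfolding PrinProjCoords_def by auto
  have "Z = map (proj_coords n (map ((*\<^sub>v) A) us)) (mat_cloud A Y)"
    using proj_coords_mat_line[OF A _ unit_reps_carrier[OF ps us(1)]] Y us(2)
    by (auto simp: mat_cloud_def)
  moreover have "map ((*\<^sub>v) A) us \<in> unit_reps (mat_cloud A ps)"
    using unit_reps_mat_cloud[OF A _ us(1)] ps(1) RP_subset_carrier by blast
  ultimately show "Z \<in> PrinProjCoords n (mat_cloud A ps) (mat_cloud A Y)"
    unfolding PrinProjCoords_def by blast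
qed

lemma PrinProjCoords_mat_cloud:
  assumes A: "orth_mat (Suc n) A" and Y: "set Y \<subseteq> RP n" and ps: "set ps \<subseteq> RP n" "length ps = Suc n"
  shows "PrinProjCoords n (mat_cloud A ps) (mat_cloud A Y) = PrinProjCoords n ps Y"
proof
  show "PrinProjCoords n ps Y \<subseteq> PrinProjCoords n (mat_cloud A ps) (mat_cloud A Y)"
    using PrinProjCoords_mat_cloud_subset[OF assms] .
  have "mat_cloud (transpose_mat A) (mat_cloud A Z) = Z" if "set Z \<subseteq> RP n" for Z
    using mat_cloud_cancel[OF A, of Z] that RP_subset_carrier by blast
  moreover have "length (mat_cloud A ps) = Suc n" using ps(2) by (simp add: mat_cloud_def)
  ultimately show "PrinProjCoords n (mat_cloud A ps) (mat_cloud A Y) \<subseteq> PrinProjCoords n ps Y"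
    using PrinProjCoords_mat_cloud_subset[OF orth_mat_transpose[OF A] mat_cloud_subset_RP[OF A Y]
        mat_cloud_subset_RP[OF A ps(1)]] Y ps(1) by simp
qed

section \<open>Sign diagonals and their action on coordinates\<close>

lemma mat_diag_mult_vec:
  fixes s :: "nat \<Rightarrow> real"
  assumes "v \<in> carrier_vec m"
  shows "mat_diag m s *\<^sub>v v = vec m (\<lambda>i. s i * v $ i)"
proof (rule eq_vecI)
  fix i assume "i < dim_vec (vec m (\<lambda>i. s i * v $ i))"
  then have i: "i < m" by simp
  have "(mat_diag m s *\<^sub>v v) $ i = (\<Sum>j = 0..<m. (if i = j then s j else 0) * v $ j)"
    using i assms by (simp add: mat_diag_def scalar_prod_def)
  also have "\<dots> = (\<Sum>j = 0..<m. if i = j then s j * v $ j else 0)"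
    by (intro sum.cong) auto
  finally show "(mat_diag m s *\<^sub>v v) $ i = vec m (\<lambda>i. s i * v $ i) $ i" using i by simp
qed (simp add: mat_diag_def)

lemma orth_mat_sign_diag:
  assumes "\<And>i. \<bar>s i\<bar> = (1::real)"
  shows "orth_mat m (mat_diag m s)"
proof -
  have T: "transpose_mat (mat_diag m s) = mat_diag m s"
    by (intro eq_matI) (auto simp: mat_diag_def)
  have "s i * s i = 1" for i using abs_mult_self_eq[of "s i"] by (simp add: assms)
  then show ?thesis unfolding orth_mat_def T by simp
qed

text \<open>Changing the signs of the coordinates amounts to changing the signs of the unit
  representatives.\<close>

lemma mat_cloud_sign_diag_PrinProjCoords:
  assumes s: "\<And>i. \<bar>s i\<bar> = (1::real)" and Y: "set Y \<subseteq> RP n"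
    and ps: "set ps \<subseteq> RP n" "length ps = Suc n" and Z: "Z \<in> PrinProjCoords n ps Y"
  shows "mat_cloud (mat_diag (Suc n) s) Z \<in> PrinProjCoords n ps Y"
proof -
  obtain us where us: "us \<in> unit_reps ps" "Z = map (proj_coords n us) Y"
    using Z unfolding PrinProjCoords_def by auto
  note usc = unit_reps_carrier[OF ps us(1)]
  define vs where "vs = map (\<lambda>i. s i \<cdot>\<^sub>v us ! i) [0..<Suc n]"
  have vs_nth: "vs ! i = s i \<cdot>\<^sub>v us ! i" if "i \<le> n" for i
    using that unfolding vs_def by (simp del: upt_Suc)
  have vsc: "\<forall>i\<le>n. vs ! i \<in> carrier_vec (Suc n)" using usc(2) vs_nth by simp
  have "vs ! i \<in> ps ! i \<and> vnorm (vs ! i) = 1" if i: "i \<le> n" for i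
  proof -
    have i': "i < length ps" using ps(2) i by simp
    have ui: "us ! i \<in> ps ! i" "vnorm (us ! i) = 1" using us(1) i' unfolding unit_reps_def by auto
    have "ps ! i \<in> RP n" using ps(1) nth_mem[OF i'] by (rule subsetD)
    then obtain u where pu: "ps ! i = line u" by (rule RP_E)
    obtain c where "us ! i = c \<cdot>\<^sub>v u"
      using ui(1) unfolding pu line_def by blast
    then have "s i \<cdot>\<^sub>v us ! i = (s i * c) \<cdot>\<^sub>v u" by (simp add: smult_smult_assoc)
    then have "s i \<cdot>\<^sub>v us ! i \<in> ps ! i" unfolding pu line_def by blast
    then show ?thesis using vs_nth[OF i] ui(2) s[of i] by (simp add: vnorm_smult)
  qed
  then have "vs \<in> unit_reps ps" unfolding unit_reps_def using ps(2) by (simp add: vs_def less_Suc_eq_le)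
  moreover have "mat_line (mat_diag (Suc n) s) (proj_coords n us p) = proj_coords n vs p"
    if "p \<in> set Y" for p
  proof -
    have "p \<in> RP n" using that Y by blast
    then obtain u where u: "u \<in> carrier_vec (Suc n)" "u \<noteq> 0\<^sub>v (Suc n)" "p = line u"
      by (rule RP_E)
    have "mat_diag (Suc n) s *\<^sub>v vec (Suc n) (\<lambda>i. u \<bullet> us ! i) = vec (Suc n) (\<lambda>i. u \<bullet> vs ! i)"
      using u(1) usc(2) vs_nth
      by (subst mat_diag_mult_vec) (auto intro!: eq_vecI simp: less_Suc_eq_le)
    then show ?thesis
      using proj_coords_line[OF u(1,2) usc(2)] proj_coords_line[OF u(1,2) vsc] u(3)
        mat_line_line[OF mat_diag_dim[of "Suc n" s], of "vec (Suc n) (\<lambda>i. u \<bullet> us ! i)"] by simp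
  qed
  then have "mat_cloud (mat_diag (Suc n) s) Z = map (proj_coords n vs) Y"
    unfolding us(2) mat_cloud_def by simp
  ultimately show ?thesis unfolding PrinProjCoords_def by blast
qed

text \<open>A sign diagonal is its own inverse, so mapping the set of coordinate clouds into itself
  already forces equality.\<close>

lemma mat_cloud_sign_diag_image_PrinProjCoords:
  assumes s: "\<And>i. \<bar>s i\<bar> = (1::real)" and Y: "set Y \<subseteq> RP n"
    and ps: "set ps \<subseteq> RP n" "length ps = Suc n"
  shows "mat_cloud (mat_diag (Suc n) s) ` PrinProjCoords n ps Y = PrinProjCoords n ps Y"
proof
  let ?A = "mat_diag (Suc n) s"
  show "mat_cloud ?A ` PrinProjCoords n ps Y \<subseteq> PrinProjCoords n ps Y"
    using mat_cloud_sign_diag_PrinProjCoords[OF assms] by (rule image_subsetI)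
  show "PrinProjCoords n ps Y \<subseteq> mat_cloud ?A ` PrinProjCoords n ps Y"
  proof
    fix Z assume Z: "Z \<in> PrinProjCoords n ps Y"
    have T: "transpose_mat ?A = ?A" by (intro eq_matI) (auto simp: mat_diag_def)
    have "\<forall>p\<in>set Z. p \<subseteq> carrier_vec (Suc n)"
      using Z unfolding PrinProjCoords_def proj_coords_def
      by (auto intro: subsetD[OF line_subset_carrier[OF vec_carrier]])
    then have "mat_cloud ?A (mat_cloud ?A Z) = Z"
      using mat_cloud_cancel[OF orth_mat_sign_diag[of s "Suc n", OF s], of Z] T by simp
    then show "Z \<in> mat_cloud ?A ` PrinProjCoords n ps Y"
      by (rule image_eqI[OF sym mat_cloud_sign_diag_PrinProjCoords[OF assms Z]])
  qed
qed

section \<open>Cocycles and the classifying map\<close>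

lemma z2_sign_add: "z2_sign (a + b) = z2_sign a * z2_sign b"
  by (cases a; cases b) (simp_all add: z2_sign_def)

lemma abs_z2_sign: "\<bar>z2_sign a\<bar> = 1"
  by (simp add: z2_sign_def)

lemma edge_val_commute: "edge_val \<tau> r j = edge_val \<tau> j r"
  by (auto simp: edge_val_def insert_commute)

text \<open>The cocycle identity on ordered triples, repetitions included, whose sets share a point.
  This is the form in which both cocycles enter \<open>f_tau\<close>.\<close>

definition satisfies_cocycle_rule ::
    "nat \<Rightarrow> (nat \<Rightarrow> 'b set) \<Rightarrow> (nat set \<Rightarrow> bit) \<Rightarrow> bool" where
  "satisfies_cocycle_rule n U \<theta> \<longleftrightarrow> (\<forall>r\<le>n. \<forall>j\<le>n. \<forall>k\<le>n. U r \<inter> U j \<inter> U k \<noteq> {} \<longrightarrow>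
     edge_val \<theta> r k = edge_val \<theta> r j + edge_val \<theta> j k)"

text \<open>For distinct indices this is the vanishing of the coboundary on the 2-simplex
  \<open>{r, j, k}\<close>, with signs irrelevant mod 2. Repeated indices reduce to
  \<open>edge_val\<close> being 0 on the diagonal, symmetric and 2-torsion.\<close>

lemma cocycle_rule:
  assumes "\<tau> \<in> cocycles n U 1"
  shows "satisfies_cocycle_rule n U \<tau>"
  unfolding satisfies_cocycle_rule_def
proof (intro allI impI)
  fix r j k assume le: "r \<le> n" "j \<le> n" "k \<le> n" and ne: "U r \<inter> U j \<inter> U k \<noteq> {}"
  have two: "x + x = 0" for x :: bit by (cases x) simp_all
  consider "r = j" | "j = k" | "r = k" | "r \<noteq> j" "j \<noteq> k" "r \<noteq> k" by blast
  then show "edge_val \<tau> r k = edge_val \<tau> r j + edge_val \<tau> j k"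
  proof cases
    case 3
    then show ?thesis using two edge_val_commute[of \<tau> r j] by (simp add: edge_val_def)
  next
    case 4
    have "{r, j, k} \<in> simplices n U (Suc 1)"
      unfolding simplices_def nerve_def using le ne 4 by auto
    moreover have "coboundary n U 1 \<tau> {r, j, k} = 0"
      using assms unfolding cocycles_def by simp
    ultimately have "(\<Sum>x\<in>{r, j, k}. \<tau> ({r, j, k} - {x})) = 0" by (simp add: coboundary_def)
    moreover have "{r, j, k} - {r} = {j, k}" "{r, j, k} - {j} = {r, k}" "{r, j, k} - {k} = {r, j}"
      using 4 by auto
    ultimately have "\<tau> {j, k} + (\<tau> {r, k} + \<tau> {r, j}) = 0" using 4 by simp
    then show ?thesis using 4
      by (cases "\<tau> {j, k}"; cases "\<tau> {r, k}"; cases "\<tau> {r, j}") (simp_all add: edge_val_def)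
  qed (simp_all add: edge_val_def)
qed

text \<open>A common point of \<open>U r\<close> and \<open>U j\<close> makes \<open>{r, j}\<close>
  an edge of the nerve, where \<open>coboundary\<close> is not cut off to 0. On the diagonal the
  correction is twice the same bit.\<close>

lemma edge_val_add_coboundary:
  assumes "r \<le> n" "j \<le> n" "U r \<inter> U j \<noteq> {}"
  shows "edge_val (\<lambda>\<sigma>. \<tau> \<sigma> + coboundary n U 0 \<alpha> \<sigma>) r j = edge_val \<tau> r j + (\<alpha> {r} + \<alpha> {j})"
proof (cases "r = j")
  case True
  then show ?thesis by (cases "\<alpha> {j}") (simp_all add: edge_val_def)
next
  case False
  have "{r, j} \<in> simplices n U (Suc 0)"
    unfolding simplices_def nerve_def using assms False by auto
  moreover have "{r, j} - {r} = {j}" "{r, j} - {j} = {r}" using False by auto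
  ultimately show ?thesis using False
    by (cases "\<alpha> {r}"; cases "\<alpha> {j}") (simp_all add: coboundary_def edge_val_def)
qed

text \<open>The value of \<open>\<alpha>\<close> at the middle index \<open>j\<close> occurs twice
  on the right and cancels mod 2.\<close>

lemma cocycle_rule_add_coboundary:
  assumes "satisfies_cocycle_rule n U \<tau>"
  shows "satisfies_cocycle_rule n U (\<lambda>\<sigma>. \<tau> \<sigma> + coboundary n U 0 \<alpha> \<sigma>)"
  unfolding satisfies_cocycle_rule_def
proof (intro allI impI)
  fix r j k assume le: "r \<le> n" "j \<le> n" "k \<le> n" and ne: "U r \<inter> U j \<inter> U k \<noteq> {}"
  have rule: "edge_val \<tau> r k = edge_val \<tau> r j + edge_val \<tau> j k"
    using assms le ne unfolding satisfies_cocycle_rule_def by blast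
  have ne': "U r \<inter> U k \<noteq> {}" "U r \<inter> U j \<noteq> {}" "U j \<inter> U k \<noteq> {}" using ne by auto
  show "edge_val (\<lambda>\<sigma>. \<tau> \<sigma> + coboundary n U 0 \<alpha> \<sigma>) r k =
      edge_val (\<lambda>\<sigma>. \<tau> \<sigma> + coboundary n U 0 \<alpha> \<sigma>) r j + edge_val (\<lambda>\<sigma>. \<tau> \<sigma> + coboundary n U 0 \<alpha> \<sigma>) j k"
    unfolding edge_val_add_coboundary[OF le(1,3) ne'(1)] edge_val_add_coboundary[OF le(1,2) ne'(2)]
      edge_val_add_coboundary[OF le(2,3) ne'(3)] rule
    by (cases "\<alpha> {r}"; cases "\<alpha> {j}"; cases "\<alpha> {k}"; cases "edge_val \<tau> r j";
        cases "edge_val \<tau> j k") simp_all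
qed

section \<open>The map \<open>f_tau\<close> and the effect of a coboundary\<close>

abbreviation f_tau_vec ::
    "nat \<Rightarrow> (nat \<Rightarrow> 'b set) \<Rightarrow> (nat \<Rightarrow> 'b \<Rightarrow> real) \<Rightarrow> (nat set \<Rightarrow> bit) \<Rightarrow> 'b \<Rightarrow> nat \<Rightarrow> real vec" where
  "f_tau_vec n U \<phi> \<tau> b j \<equiv> vec (Suc n) (\<lambda>r. z2_sign (edge_val \<tau> r j) * sqrt (ext0 U \<phi> r b))"

text \<open>Passing from chart \<open>j\<close> to chart \<open>k\<close> multiplies the whole
  vector by the sign of \<open>edge_val \<theta> j k\<close>. In entry \<open>r\<close> this is the
  cocycle rule if \<open>b\<close> lies in \<open>U r\<close>, as \<open>b\<close> is then common to
  all three sets; otherwise both entries are 0.\<close>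

lemma f_tau_eq:
  assumes rule: "satisfies_cocycle_rule n U \<theta>" and j: "j \<le> n" "b \<in> U j"
  shows "f_tau n U \<phi> \<theta> b = line (f_tau_vec n U \<phi> \<theta> b j)"
proof -
  have eq: "line (f_tau_vec n U \<phi> \<theta> b j) = line (f_tau_vec n U \<phi> \<theta> b k)" if k: "k \<le> n" "b \<in> U k" for k
  proof -
    have "z2_sign (edge_val \<theta> r k) * sqrt (ext0 U \<phi> r b) =
        z2_sign (edge_val \<theta> j k) * (z2_sign (edge_val \<theta> r j) * sqrt (ext0 U \<phi> r b))" if r: "r \<le> n" for r
    proof (cases "b \<in> U r")
      case True
      then have "U r \<inter> U j \<inter> U k \<noteq> {}" using j k by blast
      then have "edge_val \<theta> r k = edge_val \<theta> r j + edge_val \<theta> j k"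
        using rule r j k unfolding satisfies_cocycle_rule_def by blast
      then show ?thesis by (simp only: z2_sign_add mult_ac)
    qed (simp add: ext0_def)
    then have "f_tau_vec n U \<phi> \<theta> b k = z2_sign (edge_val \<theta> j k) \<cdot>\<^sub>v f_tau_vec n U \<phi> \<theta> b j"
      by (intro eq_vecI) (auto simp: less_Suc_eq_le)
    moreover have "z2_sign (edge_val \<theta> j k) \<noteq> 0" by (simp add: z2_sign_def)
    ultimately show ?thesis by (simp add: line_smult)
  qed
  show ?thesis unfolding f_tau_def
  proof (rule the_equality)
    show "\<forall>k\<le>n. b \<in> U k \<longrightarrow> line (f_tau_vec n U \<phi> \<theta> b j) = line (f_tau_vec n U \<phi> \<theta> b k)"
      using eq by blast
  qed (use j in blast)
qed

text \<open>The weights sum to 1 and so cannot all vanish; this is what places the values of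
  \<open>f_tau\<close> in \<open>RP n\<close>.\<close>

lemma f_tau_vec_nonzero:
  assumes "(\<Sum>r\<le>n. ext0 U \<phi> r b) = 1"
  shows "f_tau_vec n U \<phi> \<theta> b j \<noteq> 0\<^sub>v (Suc n)"
proof
  assume eq: "f_tau_vec n U \<phi> \<theta> b j = 0\<^sub>v (Suc n)"
  have "ext0 U \<phi> r b = 0" if "r \<le> n" for r
  proof -
    have "f_tau_vec n U \<phi> \<theta> b j $ r = 0" unfolding eq using that by simp
    then show ?thesis using that by (simp add: z2_sign_def split: if_splits)
  qed
  then show False using assms by simp
qed

text \<open>If \<open>b\<close> is outside \<open>U r\<close>, the pair \<open>{r, j}\<close> may be
  missing from the nerve and the sign formula may fail, but the entry is then 0 on both
  sides.\<close>

lemma f_tau_add_coboundary: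
  assumes rule: "satisfies_cocycle_rule n U \<tau>" and j: "j \<le> n" "b \<in> U j"
  shows "f_tau n U \<phi> (\<lambda>\<sigma>. \<tau> \<sigma> + coboundary n U 0 \<alpha> \<sigma>) b =
    mat_line (mat_diag (Suc n) (\<lambda>r. z2_sign (\<alpha> {r}))) (f_tau n U \<phi> \<tau> b)"
proof -
  let ?\<tau>' = "\<lambda>\<sigma>. \<tau> \<sigma> + coboundary n U 0 \<alpha> \<sigma>" and ?A = "mat_diag (Suc n) (\<lambda>r. z2_sign (\<alpha> {r}))"
  have "z2_sign (edge_val ?\<tau>' r j) * sqrt (ext0 U \<phi> r b) =
      z2_sign (\<alpha> {j}) * (z2_sign (\<alpha> {r}) * (z2_sign (edge_val \<tau> r j) * sqrt (ext0 U \<phi> r b)))"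
    if r: "r \<le> n" for r
  proof (cases "b \<in> U r")
    case True
    then have ne: "U r \<inter> U j \<noteq> {}" using j by blast
    show ?thesis unfolding edge_val_add_coboundary[OF r j(1) ne] z2_sign_add by (simp only: mult_ac)
  qed (simp add: ext0_def)
  then have "f_tau_vec n U \<phi> ?\<tau>' b j = z2_sign (\<alpha> {j}) \<cdot>\<^sub>v (?A *\<^sub>v f_tau_vec n U \<phi> \<tau> b j)"
    by (subst mat_diag_mult_vec) (auto intro!: eq_vecI simp: less_Suc_eq_le)
  moreover have "z2_sign (\<alpha> {j}) \<noteq> 0" by (simp add: z2_sign_def)
  ultimately have "line (f_tau_vec n U \<phi> ?\<tau>' b j) = line (?A *\<^sub>v f_tau_vec n U \<phi> \<tau> b j)"
    by (simp add: line_smult)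
  then show ?thesis
    unfolding f_tau_eq[OF rule j] f_tau_eq[OF cocycle_rule_add_coboundary[OF rule] j]
    using mat_line_line[OF mat_diag_dim, of "f_tau_vec n U \<phi> \<tau> b j" "Suc n"] by simp
qed

theorem mainTheorem8:
  fixes B :: "'b topology" and n :: nat and U :: "nat \<Rightarrow> 'b set"
    and \<phi> :: "nat \<Rightarrow> 'b \<Rightarrow> real" and \<tau> \<tau>' \<alpha> :: "nat set \<Rightarrow> bit"
    and A :: "real mat" and xs :: "'b list" and Y Y' :: "real vec set list"
  assumes "paracompact_space B" and "Hausdorff_space B"
    and "\<forall>r\<le>n. openin B (U r)" and "(\<Union>r\<le>n. U r) = topspace B"
    and "dominated_partition_of_unity B n U \<phi>"
    and "\<tau> \<in> cocycles n U 1" and "\<alpha> \<in> cochains n U 0"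
    and "\<tau>' = (\<lambda>\<sigma>. \<tau> \<sigma> + coboundary n U 0 \<alpha> \<sigma>)"
    and "A = mat_diag (Suc n) (\<lambda>r. z2_sign (\<alpha> {r}))"
    and "set xs \<subseteq> topspace B"
    and "Y = map (f_tau n U \<phi> \<tau>) xs"
    and "Y' = map (f_tau n U \<phi> \<tau>') xs"
  shows
    "(\<forall>\<theta>\<in>{\<tau>, \<tau>'}. \<forall>b\<in>topspace B. f_tau n U \<phi> \<theta> b \<in> RP n \<and>
        (\<forall>j\<le>n. b \<in> U j \<longrightarrow> f_tau n U \<phi> \<theta> b =
           line (vec (Suc n) (\<lambda>r. z2_sign (edge_val \<theta> r j) * sqrt (ext0 U \<phi> r b)))))
     \<and> Y' = mat_cloud A Y
     \<and> PrinProjComps n Y' = mat_cloud A ` PrinProjComps n Y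
     \<and> (\<forall>ps\<in>PrinProjComps n Y. var_profile n Y' (mat_cloud A ps) = var_profile n Y ps)
     \<and> var_profile n Y' ` PrinProjComps n Y' = var_profile n Y ` PrinProjComps n Y
     \<and> (\<forall>ps\<in>PrinProjComps n Y.
          PrinProjCoords n (mat_cloud A ps) Y' = mat_cloud A ` PrinProjCoords n ps Y)
     \<and> bij_betw (mat_line A) (RP n) (RP n)
     \<and> (\<forall>p\<in>RP n. \<forall>q\<in>RP n. proj_dist (mat_line A p) (mat_line A q) = proj_dist p q)"
proof -
  note cover = assms(4) and pou = assms(5) and \<tau> = assms(6) and \<tau>'_def = assms(8)
    and A_def = assms(9) and xs = assms(10) and Y_def = assms(11) and Y'_def = assms(12)
  have rule: "satisfies_cocycle_rule n U \<theta>" if "\<theta> \<in> {\<tau>, \<tau>'}" for \<theta>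
    using that cocycle_rule[OF \<tau>] cocycle_rule_add_coboundary[OF cocycle_rule[OF \<tau>]]
    unfolding \<tau>'_def by auto
  have ex_j: "\<exists>j\<le>n. b \<in> U j" if "b \<in> topspace B" for b
    using that cover by blast
  have RP: "f_tau n U \<phi> \<theta> b \<in> RP n" if "\<theta> \<in> {\<tau>, \<tau>'}" "b \<in> topspace B" for \<theta> b
  proof -
    obtain j where j: "j \<le> n" "b \<in> U j" using ex_j[OF \<open>b \<in> topspace B\<close>] by blast
    have "(\<Sum>r\<le>n. ext0 U \<phi> r b) = 1"
      using pou \<open>b \<in> topspace B\<close> unfolding dominated_partition_of_unity_def by blast
    then show ?thesis
      unfolding f_tau_eq[OF rule[OF \<open>\<theta> \<in> {\<tau>, \<tau>'}\<close>] j]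
      by (rule line_in_RP[OF vec_carrier f_tau_vec_nonzero])
  qed
  have well_defined: "\<forall>\<theta>\<in>{\<tau>, \<tau>'}. \<forall>b\<in>topspace B. f_tau n U \<phi> \<theta> b \<in> RP n \<and>
      (\<forall>j\<le>n. b \<in> U j \<longrightarrow> f_tau n U \<phi> \<theta> b = line (f_tau_vec n U \<phi> \<theta> b j))"
    using RP f_tau_eq[OF rule] by blast
  have A: "orth_mat (Suc n) A"
    unfolding A_def by (rule orth_mat_sign_diag) (rule abs_z2_sign)
  have YRP: "set Y \<subseteq> RP n" using RP xs unfolding Y_def by auto
  have Y': "Y' = mat_cloud A Y"
  proof -
    have "f_tau n U \<phi> \<tau>' b = mat_line A (f_tau n U \<phi> \<tau> b)" if "b \<in> set xs" for b
    proof -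
      obtain j where "j \<le> n" "b \<in> U j" using ex_j xs \<open>b \<in> set xs\<close> by blast
      then show ?thesis
        unfolding \<tau>'_def A_def by (rule f_tau_add_coboundary[OF cocycle_rule[OF \<tau>]])
    qed
    then show ?thesis unfolding Y_def Y'_def mat_cloud_def by simp
  qed
  have comps: "PrinProjComps n Y' = mat_cloud A ` PrinProjComps n Y"
    unfolding Y' by (rule PrinProjComps_mat_cloud[OF A YRP])
  have var: "\<forall>ps\<in>PrinProjComps n Y. var_profile n Y' (mat_cloud A ps) = var_profile n Y ps"
    unfolding Y' using var_profile_mat_cloud[OF A YRP] by blast
  have vars: "var_profile n Y' ` PrinProjComps n Y' = var_profile n Y ` PrinProjComps n Y"
    unfolding comps image_image using var by (intro image_cong[OF refl]) simp
  have coords: "\<forall>ps\<in>PrinProjComps n Y.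
      PrinProjCoords n (mat_cloud A ps) Y' = mat_cloud A ` PrinProjCoords n ps Y"
  proof
    fix ps assume ps: "ps \<in> PrinProjComps n Y"
    note psRP = PrinProjComps_subset_RP[OF ps]
    have len: "length ps = Suc n" using ps unfolding PrinProjComps_def by simp
    \<comment> \<open>Both sides of the goal equal \<open>PrinProjCoords n ps Y\<close>: the right
      one by reshuffling unit representatives, the left one by invariance of inner products.\<close>
    have "mat_cloud A ` PrinProjCoords n ps Y = PrinProjCoords n ps Y"
      unfolding A_def by (rule mat_cloud_sign_diag_image_PrinProjCoords[OF abs_z2_sign YRP psRP len])
    then show "PrinProjCoords n (mat_cloud A ps) Y' = mat_cloud A ` PrinProjCoords n ps Y"
      unfolding Y' using PrinProjCoords_mat_cloud[OF A YRP psRP len] by simp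
  qed
  have isom: "\<forall>p\<in>RP n. \<forall>q\<in>RP n. proj_dist (mat_line A p) (mat_line A q) = proj_dist p q"
    using proj_dist_mat_line[OF A] by blast
  show ?thesis
    by (intro conjI well_defined Y' comps var vars coords bij_betw_mat_line[OF A] isom)
qed

end
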